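(* Let $u$ and $v$ be two positive integers, let $m \neq \pm 1$ be a square free rational integer, and let $F(x) = x^{2^u\cdot 3^v}-m$, a monic irreducible polynomial over $\mathbb{Q}$. Let $\alpha$ be a complex root of $F(x)$ and let $K=\mathbb{Q}(\alpha)$. If $m\equiv 1 \pmod 4$ or $m\equiv 1 \pmod 9$, then $K$ is not monogenic.
   Context: A number field $K$ of degree $n$ over $\mathbb{Q}$ with ring of integers $\mathbb{Z}_K$ is called monogenic if $\mathbb{Z}_K$ has a $\mathbb{Z}$-basis of the form $(1,\theta,\dots,\theta^{n-1})$ for some $\theta\in\mathbb{Z}_K$ (equivalently, $\mathbb{Z}_K=\mathbb{Z}[\theta]$ for some $\theta\in\mathbb{Z}_K$); otherwise $K$ is not monogenic. *)

theory Defs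
  imports Complex_Main
    "HOL-Computational_Algebra.Computational_Algebra"
    "HOL-Number_Theory.Cong"
    "HOL-Algebra.Generated_Fields"
    "HOL-Algebra.Algebraic_Closure_Type"
begin

text \<open>Number fields are represented as subfields of the complex numbers.
  \<open>ring_of_type_algebra\<close> is the HOL-Algebra record for the type-class ring structure.\<close>

definition rat_adjoin :: "complex \<Rightarrow> complex set" where
  "rat_adjoin \<alpha> = generate_field ring_of_type_algebra {\<alpha>}"

definition rat_scale :: "rat \<Rightarrow> complex \<Rightarrow> complex" where
  "rat_scale q x = of_rat q * x"

definition int_scale :: "int \<Rightarrow> complex \<Rightarrow> complex" where
  "int_scale k x = of_int k * x"

lemma vector_space_rat_scale: "vector_space rat_scale"
  by unfold_locales (auto simp: rat_scale_def algebra_simps of_rat_add of_rat_mult)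

lemma module_int_scale: "Modules.module int_scale"
  by unfold_locales (auto simp: int_scale_def algebra_simps)

definition field_degree :: "complex set \<Rightarrow> nat" where
  "field_degree K = vector_space.dim rat_scale K"

definition ring_of_integers :: "complex set \<Rightarrow> complex set" where
  "ring_of_integers K = {x \<in> K. algebraic_int x}"

text \<open>A basis is a family here, so \<open>distinct\<close> is part of linear independence.\<close>

definition is_int_basis :: "complex list \<Rightarrow> complex set \<Rightarrow> bool" where
  "is_int_basis bs M \<longleftrightarrow>
     distinct bs \<and> \<not> Modules.module.dependent int_scale (set bs) \<and> Modules.module.span int_scale (set bs) = M"

definition monogenic :: "complex set \<Rightarrow> bool" where
  "monogenic K \<longleftrightarrow>
     (\<exists>\<theta>\<in>ring_of_integers K.
        is_int_basis (map (\<lambda>i. \<theta> ^ i) [0..<field_degree K]) (ring_of_integers K))"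

end

(*
  Z_K maps to a residue field F_q through each complex root x of X^n - m, by reducing the conjugate
  g(x) of g(alpha) modulo the maximal ideal M of a valuation ring V of the complex numbers above p
  (p = 2 or 3). If Z_K = Z[theta], such a map is determined by the image of theta, so at most q of
  them have values in F_q. There are too many: six with values in F_4 if m = 1 mod 4, four with
  values in F_3 if m = 1 mod 9. For p = 2 take both square roots s of m, and for p = 3 two suitable
  cube roots s of m; (s + 1)/2, resp. (1 + s + s^2)/3, separates them. The roots x above s then
  differ mod M by the cube roots of unity, resp. by sign.

  That reduction has values in F_q is a local statement about Q_p(x), resp. Q_2(omega, x), which is
  totally ramified over Q_p, resp. Q_2(omega). Completions are avoided: the ring of integers of the
  local field is replaced by the set C of those z in V that are approximated modulo every power of
  a uniformizer pi by polynomials in pi with coefficients in Z, resp. Z[omega]. Hensel's lemma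
  becomes a fixed point argument for C.
*)

theory Submission
  imports Defs
begin

section \<open>Valuation rings of the complex numbers\<close>

text \<open>The part of the degree prime to \<open>p\<close> makes the count succeed: the two square
  roots alone give two maps into F_2, which is no contradiction. Total ramification comes from the
  \<open>p\<close>-part. If \<open>\<eta>\<close> is a \<open>p ^ t\<close>-th root of
  \<open>1 + p * c\<close>, the binomial theorem gives \<open>(\<eta> - 1) ^ (p ^ t) = p * w\<close>
  with \<open>w\<close> congruent to \<open>c\<close>, an equation of Eisenstein type as long as
  \<open>c\<close> is a unit. The obstacle is a \<open>c\<close> in \<open>M\<close>. Then
  \<open>1 + p * c\<close> is a \<open>p\<close>-th power in the local base field, and another of
  its \<open>p\<close>-th roots is used: for \<open>p = 2\<close> the root \<open>1 + 2 * c'\<close>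
  whose sign makes \<open>c'\<close> a unit, for \<open>p = 3\<close> the root
  \<open>\<omega> * (1 + 3 * c')\<close>, which is far enough from 1 for every \<open>c'\<close>. A
  valuation ring of all complex numbers lets the conjugates of \<open>\<alpha>\<close> be compared
  directly and contains the roots of all auxiliary monic equations.\<close>

locale unital_subring =
  fixes R :: "'a::comm_ring_1 set"
  assumes one_closed: "1 \<in> R"
    and diff_closed: "x \<in> R \<Longrightarrow> y \<in> R \<Longrightarrow> x - y \<in> R"
    and mult_closed: "x \<in> R \<Longrightarrow> y \<in> R \<Longrightarrow> x * y \<in> R"
begin

lemma zero_closed: "0 \<in> R"
  using diff_closed[OF one_closed one_closed] by simp

lemma uminus_closed: "x \<in> R \<Longrightarrow> - x \<in> R"
  using diff_closed[OF zero_closed, of x] by simp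

lemma add_closed: "x \<in> R \<Longrightarrow> y \<in> R \<Longrightarrow> x + y \<in> R"
  using diff_closed[OF _ uminus_closed, of x y] by simp

lemma power_closed: "x \<in> R \<Longrightarrow> x ^ n \<in> R"
  by (induction n) (auto intro: one_closed mult_closed)

lemma of_nat_closed: "of_nat n \<in> R"
  by (induction n) (auto intro: zero_closed one_closed add_closed)

lemma of_int_closed: "of_int k \<in> R"
  by (cases k rule: int_cases2) (auto intro: of_nat_closed uminus_closed)

lemma numeral_closed: "numeral k \<in> R"
  using of_nat_closed[of "numeral k"] by simp

lemma sum_closed: "(\<And>i. i \<in> I \<Longrightarrow> f i \<in> R) \<Longrightarrow> sum f I \<in> R"
  by (induction I rule: infinite_finite_induct) (auto intro: zero_closed add_closed)

lemma poly_closed: "(\<And>i. coeff f i \<in> R) \<Longrightarrow> x \<in> R \<Longrightarrow> poly f x \<in> R"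
  unfolding poly_altdef by (intro sum_closed mult_closed power_closed) auto

lemmas closed = one_closed zero_closed diff_closed mult_closed uminus_closed add_closed
  power_closed of_nat_closed of_int_closed numeral_closed

lemma adjoin_subring: "unital_subring {poly f x | f. \<forall>i. coeff f i \<in> R}"
proof
  show "1 \<in> {poly f x | f. \<forall>i. coeff f i \<in> R}"
    by (rule CollectI, rule exI[of _ 1]) (auto simp: coeff_1 closed)
next
  fix a b assume "a \<in> {poly f x | f. \<forall>i. coeff f i \<in> R}" "b \<in> {poly f x | f. \<forall>i. coeff f i \<in> R}"
  then obtain f g where fg: "a = poly f x" "b = poly g x" "\<forall>i. coeff f i \<in> R" "\<forall>i. coeff g i \<in> R"
    by auto
  show "a - b \<in> {poly f x | f. \<forall>i. coeff f i \<in> R}"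
    using fg by (intro CollectI exI[of _ "f - g"]) (auto intro: closed)
  show "a * b \<in> {poly f x | f. \<forall>i. coeff f i \<in> R}"
    using fg by (intro CollectI exI[of _ "f * g"]) (auto simp: coeff_mult intro!: closed sum_closed)
qed

end

text \<open>Source of all valuation rings in use: applied to the integers with
  \<open>z = inverse p\<close>, it replaces the extension of the \<open>p\<close>-adic valuation to
  the complex numbers.\<close>

lemma maximal_subring_avoiding:
  fixes z :: "'a::comm_ring_1"
  assumes "unital_subring R0" and "z \<notin> R0"
  obtains R where "unital_subring R" "z \<notin> R" "\<And>S. unital_subring S \<Longrightarrow> R \<subset> S \<Longrightarrow> z \<in> S"
proof -
  define \<A> where "\<A> = {R. unital_subring R \<and> z \<notin> R}"
  have "\<exists>R\<in>\<A>. \<forall>S\<in>\<A>. R \<subseteq> S \<longrightarrow> S = R"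
  proof (rule subset_Zorn_nonempty)
    show "\<A> \<noteq> {}" using assms by (auto simp: \<A>_def)
  next
    fix \<C> assume ne: "\<C> \<noteq> {}" and ch: "subset.chain \<A> \<C>"
    have sub: "unital_subring R" "z \<notin> R" if "R \<in> \<C>" for R
      using ch that by (auto simp: subset.chain_def \<A>_def)
    have common: "\<exists>R\<in>\<C>. a \<in> R \<and> b \<in> R" if "a \<in> \<Union>\<C>" "b \<in> \<Union>\<C>" for a b
    proof -
      obtain S T where ST: "S \<in> \<C>" "T \<in> \<C>" "a \<in> S" "b \<in> T" using \<open>a \<in> _\<close> \<open>b \<in> _\<close> by blast
      then have "S \<subseteq> T \<or> T \<subseteq> S" using ch by (auto simp: subset_chain_def)
      then show ?thesis using ST by blast
    qed
    have "unital_subring (\<Union>\<C>)"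
    proof
      show "1 \<in> \<Union>\<C>" using ne sub(1) unital_subring.one_closed by blast
    next
      fix a b assume "a \<in> \<Union>\<C>" "b \<in> \<Union>\<C>"
      then obtain R where "R \<in> \<C>" "a \<in> R" "b \<in> R" using common by blast
      then show "a - b \<in> \<Union>\<C>" "a * b \<in> \<Union>\<C>"
        using sub(1)[of R] unital_subring.diff_closed unital_subring.mult_closed by blast+
    qed
    then show "\<Union>\<C> \<in> \<A>" using sub(2) by (auto simp: \<A>_def)
  qed
  then obtain R where "R \<in> \<A>" "\<forall>S\<in>\<A>. R \<subseteq> S \<longrightarrow> S = R" by blast
  then show ?thesis by (intro that[of R]) (auto simp: \<A>_def)
qed

section \<open>Maximal subrings avoiding \<open>inverse p\<close> are valuation rings\<close>

context
  fixes R :: "'a::field set" and p :: 'a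
  assumes sub: "unital_subring R" and p: "p \<in> R" "p \<noteq> 0" and avoid: "inverse p \<notin> R"
    and maxi: "\<And>S. unital_subring S \<Longrightarrow> R \<subset> S \<Longrightarrow> inverse p \<in> S"
begin

interpretation unital_subring R by (fact sub)

lemma maximal_subring_adjoin:
  assumes "x \<notin> R"
  obtains f where "\<forall>i. coeff f i \<in> R" "poly f x = inverse p"
proof -
  let ?S = "{poly f x | f. \<forall>i. coeff f i \<in> R}"
  have "a \<in> ?S" if "a \<in> R" for a
    using that by (intro CollectI exI[of _ "[:a:]"]) (auto simp: coeff_pCons closed split: nat.splits)
  moreover have "x \<in> ?S"
    by (intro CollectI exI[of _ "[:0,1:]"]) (auto simp: coeff_pCons closed split: nat.splits)
  ultimately have "R \<subset> ?S" using assms by blast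
  with maxi[OF adjoin_subring] have "inverse p \<in> ?S" by simp
  with that show ?thesis by auto
qed

text \<open>An inverse of \<open>u = 1 - p * b\<close> outside \<open>R\<close> would make
  \<open>inverse p\<close> a polynomial in \<open>inverse u\<close>. Clearing powers of
  \<open>u\<close> gives \<open>u ^ n = p * r\<close>, whereas every power of \<open>u\<close> is 1
  modulo \<open>p\<close>; together they make \<open>p\<close> invertible in
  \<open>R\<close>.\<close>

lemma maximal_subring_unit:
  assumes "b \<in> R" shows "1 - p * b \<noteq> 0" "inverse (1 - p * b) \<in> R"
proof -
  let ?u = "1 - p * b"
  show nz: "?u \<noteq> 0"
  proof
    assume "?u = 0"
    then have "p * b = 1" by simp
    then have "inverse p = b" using p by (simp add: field_simps)
    then show False using assms avoid by simp
  qed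
  have u: "?u \<in> R" using assms p by (intro closed)
  show "inverse ?u \<in> R"
  proof (rule ccontr)
    assume "inverse ?u \<notin> R"
    then obtain f where f: "\<forall>i. coeff f i \<in> R" "poly f (inverse ?u) = inverse p"
      by (rule maximal_subring_adjoin)
    have pw: "\<exists>c\<in>R. ?u ^ k = 1 - p * c" for k
    proof (induction k)
      case (Suc k)
      then obtain c where c: "c \<in> R" "?u ^ k = 1 - p * c" by blast
      have "?u ^ Suc k = 1 - p * (b + c - p * b * c)"
        unfolding power_Suc c(2) by (simp add: algebra_simps)
      then show ?case using p(1) assms c(1) by (intro bexI[of _ "b + c - p * b * c"] closed) auto
    qed (auto intro!: bexI[of _ 0] closed)
    let ?n = "degree f"
    define r where "r = (\<Sum>i\<le>?n. coeff f i * ?u ^ (?n - i))"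
    have r: "r \<in> R" unfolding r_def using f u
      by (intro sum_closed mult_closed power_closed) auto
    have "poly f (inverse ?u) * ?u ^ ?n = r"
      unfolding poly_altdef r_def sum_distrib_right
    proof (rule sum.cong)
      fix i assume "i \<in> {..?n}"
      then have "?u ^ ?n = ?u ^ i * ?u ^ (?n - i)" by (simp flip: power_add)
      then show "coeff f i * inverse ?u ^ i * ?u ^ ?n = coeff f i * ?u ^ (?n - i)"
        using nz by (simp add: field_simps)
    qed simp
    then have e: "?u ^ ?n = p * r" using f(2) p by (auto simp: field_simps)
    obtain c where c: "c \<in> R" "?u ^ ?n = 1 - p * c" using pw by blast
    then have "p * (r + c) = 1" using e by (simp add: algebra_simps)
    then have "inverse p = r + c" using p by (simp add: field_simps)
    then show False using avoid closed(6)[OF r c(1)] by simp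
  qed
qed

text \<open>The relation at \<open>inverse x\<close>, multiplied by \<open>x ^ degree f\<close>, expresses the top power of
  \<open>x\<close> in \<open>f\<close> by lower ones. Exchanging \<open>x\<close> and \<open>inverse x\<close> this contradicts the minimality of one
  of the two degrees.\<close>

lemma maximal_subring_descent:
  assumes f: "\<forall>i. coeff f i \<in> R" "poly f x = inverse p"
    and g: "\<forall>i. coeff g i \<in> R" "poly g (inverse x) = inverse p"
    and x: "x \<noteq> 0" and deg: "degree g \<le> degree f" "degree f > 0"
  obtains h where "\<forall>i. coeff h i \<in> R" "poly h x = inverse p" "degree h < degree f"
proof -
  let ?u = "inverse (1 - p * coeff g 0)"
  have nz: "1 - p * coeff g 0 \<noteq> 0" and u: "?u \<in> R" using maximal_subring_unit g(1) by auto
  let ?m = "degree g" let ?n = "degree f"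
  define k where "k = (\<Sum>j\<in>{1..?m}. monom (?u * p * coeff g j) (?n - j))"
  have kR: "coeff k i \<in> R" for i
    unfolding k_def coeff_sum using g u p by (intro sum_closed) (auto intro!: closed)
  \<comment> \<open>Collecting the constant term on the left leaves the factor
    \<open>1 - p * coeff g 0\<close>, a unit of \<open>R\<close>; dividing by it keeps the
    coefficients in \<open>R\<close>.\<close>
  have "inverse p = coeff g 0 + (\<Sum>j\<in>{1..?m}. coeff g j * inverse x ^ j)"
    using g(2) unfolding poly_altdef atMost_atLeast0 by (simp add: sum.atLeast_Suc_atMost)
  then have "1 - p * coeff g 0 = p * (\<Sum>j\<in>{1..?m}. coeff g j * inverse x ^ j)"
    using p by (simp add: field_simps)
  then have "?u * (1 - p * coeff g 0) = ?u * (p * (\<Sum>j\<in>{1..?m}. coeff g j * inverse x ^ j))"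
    by (rule arg_cong)
  then have "1 = ?u * p * (\<Sum>j\<in>{1..?m}. coeff g j * inverse x ^ j)"
    using left_inverse[OF nz] by (simp only: mult.assoc)
  from arg_cong[OF this, of "\<lambda>t. t * x ^ ?n"]
  have "x ^ ?n = (\<Sum>j\<in>{1..?m}. ?u * p * coeff g j * (inverse x ^ j * x ^ ?n))"
    by (simp only: mult_1 sum_distrib_left sum_distrib_right mult.assoc)
  also have "\<dots> = (\<Sum>j\<in>{1..?m}. ?u * p * coeff g j * x ^ (?n - j))"
  proof (rule sum.cong)
    fix j assume "j \<in> {1..?m}"
    then have "x ^ ?n = x ^ j * x ^ (?n - j)" using deg by (simp flip: power_add)
    then have "inverse x ^ j * x ^ ?n = x ^ (?n - j)" using x by (simp add: field_simps)
    then show "?u * p * coeff g j * (inverse x ^ j * x ^ ?n) = ?u * p * coeff g j * x ^ (?n - j)"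
      by simp
  qed simp
  also have "\<dots> = poly k x" unfolding k_def by (simp add: poly_sum poly_monom)
  finally have xk: "x ^ ?n = poly k x" .
  have dk: "degree k < ?n"
    unfolding k_def
    by (intro degree_sum_less) (use deg in \<open>auto intro!: le_less_trans[OF degree_monom_le]\<close>)
  define h where "h = f - monom (lead_coeff f) ?n + smult (lead_coeff f) k"
  have "degree (f - monom (lead_coeff f) ?n) < ?n"
  proof -
    have "degree (f - monom (lead_coeff f) ?n) \<le> ?n - 1"
    proof (intro degree_le allI impI)
      fix i assume "?n - 1 < i"
      then have "i \<ge> ?n" by simp
      then show "coeff (f - monom (lead_coeff f) ?n) i = 0"
        by (cases "i = ?n") (auto simp: coeff_eq_0)
    qed
    then show ?thesis using deg by simp
  qed
  then have "degree h < ?n" unfolding h_def using dk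
    by (meson degree_add_less degree_smult_le le_less_trans)
  moreover have "poly h x = inverse p"
    unfolding h_def using f xk by (simp add: poly_monom)
  moreover have "coeff h i \<in> R" for i
    unfolding h_def using f kR by (auto intro!: closed)
  ultimately show ?thesis using that by blast
qed

lemma maximal_subring_valuation: "x \<in> R \<or> inverse x \<in> R"
proof (rule ccontr)
  assume neg: "\<not> (x \<in> R \<or> inverse x \<in> R)"
  define P where "P = (\<lambda>x (f::'a poly). (\<forall>i. coeff f i \<in> R) \<and> poly f x = inverse p)"
  have ex: "\<exists>f. P x f" "\<exists>f. P (inverse x) f"
    using neg maximal_subring_adjoin unfolding P_def by metis+
  define f where "f = arg_min degree (P x)"
  define g where "g = arg_min degree (P (inverse x))"
  have f: "P x f" "\<And>h. P x h \<Longrightarrow> degree f \<le> degree h"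
    unfolding f_def using ex(1) by (auto intro: arg_min_natI arg_min_nat_le)
  have g: "P (inverse x) g" "\<And>h. P (inverse x) h \<Longrightarrow> degree g \<le> degree h"
    unfolding g_def using ex(2) by (auto intro: arg_min_natI arg_min_nat_le)
  have pos: "degree h > 0" if "P y h" for y h
  proof (rule ccontr)
    assume "\<not> degree h > 0"
    then obtain a where "h = [:a:]" by (metis degree_eq_zeroE neq0_conv)
    with that have "a = inverse p" "a \<in> R" unfolding P_def by (auto dest: spec[of _ 0])
    with avoid show False by simp
  qed
  have x: "x \<noteq> 0" using neg zero_closed by auto
  consider "degree g \<le> degree f" | "degree f \<le> degree g" by linarith
  then show False
  proof cases
    case 1
    then obtain h where "P x h" "degree h < degree f"
      using maximal_subring_descent[of f x g] f(1) g(1) x pos[OF f(1)] unfolding P_def by metis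
    then show False using f(2) by force
  next
    case 2
    then obtain h where "P (inverse x) h" "degree h < degree g"
      using maximal_subring_descent[of g "inverse x" f] f(1) g(1) x pos[OF g(1)] unfolding P_def
      by (metis inverse_inverse_eq nonzero_imp_inverse_nonzero)
    then show False using g(2) by force
  qed
qed

end

section \<open>Places: the maximal ideal and integral closedness\<close>

locale place = unital_subring V for V :: "complex set" +
  fixes p :: nat
  assumes prime_p: "Factorial_Ring.prime p"
    and valuation: "x \<in> V \<or> inverse x \<in> V"
    and inverse_p: "inverse (of_nat p) \<notin> V"
begin

text \<open>Zero is listed apart since \<open>inverse 0 = 0\<close> would make it look like a
  unit.\<close>

definition M :: "complex set" where "M = {x \<in> V. x = 0 \<or> inverse x \<notin> V}"

lemma M_V: "x \<in> M \<Longrightarrow> x \<in> V"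
  by (simp add: M_def)

lemma zero_M: "0 \<in> M"
  by (simp add: M_def closed)

lemma one_not_M: "1 \<notin> M"
  by (simp add: M_def closed)

lemma p_M: "of_nat p \<in> M"
  using inverse_p by (simp add: M_def closed)

lemma inverse_closed: "x \<in> V \<Longrightarrow> x \<notin> M \<Longrightarrow> inverse x \<in> V"
  by (auto simp: M_def)

lemma not_M_nz: "x \<notin> M \<Longrightarrow> x \<noteq> 0"
  using zero_M by auto

lemma M_mult:
  assumes "x \<in> V" "y \<in> M" shows "x * y \<in> M"
proof (cases "x * y = 0")
  case False
  have "inverse y \<in> V" if "inverse (x * y) \<in> V"
    using mult_closed[OF assms(1) that] False by (simp add: field_simps)
  then show ?thesis using assms False by (auto simp: M_def intro: closed)
qed (metis zero_M)

lemma M_mult': "x \<in> M \<Longrightarrow> y \<in> V \<Longrightarrow> x * y \<in> M"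
  using M_mult[of y x] by (simp add: mult.commute)

text \<open>One of the quotients \<open>x / y\<close> and \<open>y / x\<close> lies in
  \<open>V\<close>, so the sum is a \<open>V\<close>-multiple of one of the summands.\<close>

lemma M_add:
  assumes "x \<in> M" "y \<in> M" shows "x + y \<in> M"
proof (cases "x = 0 \<or> y = 0")
  case False
  then have "x + y = (1 + x / y) * y" "x + y = (1 + y / x) * x"
    by (auto simp: field_simps)
  moreover have "x / y \<in> V \<or> y / x \<in> V"
    using valuation[of "x / y"] by (simp add: field_simps)
  ultimately show ?thesis
    using M_mult assms closed by metis
qed (use assms in auto)

lemma M_uminus: "x \<in> M \<Longrightarrow> - x \<in> M"
  using M_mult[of "-1" x] closed by simp

lemma M_diff: "x \<in> M \<Longrightarrow> y \<in> M \<Longrightarrow> x - y \<in> M"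
  using M_add[OF _ M_uminus, of x y] by simp

lemma M_prime: "x \<in> V \<Longrightarrow> y \<in> V \<Longrightarrow> x * y \<in> M \<Longrightarrow> x \<in> M \<or> y \<in> M"
  by (auto simp: M_def closed)

lemma M_power: "x \<in> V \<Longrightarrow> x ^ n \<in> M \<Longrightarrow> x \<in> M"
proof (induction n)
  case (Suc n)
  then show ?case using M_prime[of x "x ^ n"] power_closed by auto
qed (use one_not_M in simp)

lemma M_of_int_iff: "of_int k \<in> M \<longleftrightarrow> int p dvd k"
proof
  assume "int p dvd k"
  then obtain l where "k = int p * l" by auto
  then show "of_int k \<in> M" using M_mult'[OF p_M of_int_closed[of l]] by simp
next
  assume k: "of_int k \<in> M"
  show "int p dvd k"
  proof (rule ccontr)
    assume "\<not> int p dvd k"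
    then have "coprime (int p) k" using prime_p by (simp add: prime_imp_coprime)
    then obtain a b where "a * int p + b * k = 1" by (metis cong_solve_coprime_int bezout_int coprime_iff_gcd_eq_1)
    then have "(1::complex) = of_int a * of_nat p + of_int b * of_int k"
      by (metis of_int_1 of_int_add of_int_mult of_int_of_nat_eq)
    then show False
      using one_not_M M_add[OF M_mult[OF of_int_closed p_M] M_mult[OF of_int_closed k]] by metis
  qed
qed

text \<open>For \<open>z\<close> outside \<open>V\<close> the inverse \<open>w\<close> lies in
  \<open>M\<close>. Dividing the equation by the top power of \<open>z\<close>, that is, passing to
  the reflected polynomial, gives \<open>1 + w * poly g w = 0\<close>, so 1 would lie in
  \<open>M\<close>.\<close>

lemma monic_root_closed:
  assumes "lead_coeff f = 1" "\<And>i. coeff f i \<in> V" "poly f z = 0"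
  shows "z \<in> V"
proof (rule ccontr)
  assume z: "z \<notin> V"
  then have nz: "z \<noteq> 0" using closed by auto
  let ?w = "inverse z"
  have w: "?w \<in> M" using z valuation[of z] by (simp add: M_def)
  obtain c g where g: "reflect_poly f = pCons c g" by (rule pCons_cases)
  have "c = 1" using assms(1) g by (metis coeff_0_reflect_poly coeff_pCons_0)
  have "poly (reflect_poly f) ?w = 0" using assms(3) nz by (simp add: poly_reflect_poly_nz)
  then have "?w * poly g ?w = - 1" using g \<open>c = 1\<close>
    by (simp add: eq_neg_iff_add_eq_0 add.commute)
  moreover have "coeff g i \<in> V" for i
  proof -
    have "coeff g i = coeff (reflect_poly f) (Suc i)" using g by simp
    then show ?thesis using assms(2) closed by (simp add: coeff_reflect_poly)
  qed
  then have "poly g ?w \<in> V" using w M_V by (intro poly_closed) auto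
  ultimately show False using M_mult'[OF w] M_uminus one_not_M by fastforce
qed

lemma algebraic_int_closed: "algebraic_int x \<Longrightarrow> x \<in> V"
  by (erule algebraic_int.cases) (metis Ints_cases monic_root_closed of_int_closed)

lemma quadratic_root_closed:
  assumes "b \<in> V" "c \<in> V" "z\<^sup>2 + b * z + c = 0" shows "z \<in> V"
proof (rule monic_root_closed[of "[:c, b, 1:]"])
  show "poly [:c, b, 1:] z = 0"
    using assms(3) by (simp add: algebra_simps power2_eq_square)
qed (use assms closed in \<open>auto simp: coeff_pCons split: nat.splits\<close>)

lemma cubic_root_closed:
  assumes "a \<in> V" "b \<in> V" "c \<in> V" "z ^ 3 + a * z\<^sup>2 + b * z + c = 0" shows "z \<in> V"
proof (rule monic_root_closed[of "[:c, b, a, 1:]"])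
  show "poly [:c, b, a, 1:] z = 0"
    using assms(4) by (simp add: algebra_simps power2_eq_square power3_eq_cube)
qed (use assms closed in \<open>auto simp: coeff_pCons split: nat.splits\<close>)

end

lemma place_exists:
  assumes "Factorial_Ring.prime p"
  obtains V where "place V p"
proof -
  have Z: "unital_subring (\<int> :: complex set)" by standard auto
  have p1: "(of_nat p :: complex) \<noteq> 0" "p > 1" using assms prime_gt_1_nat by (auto simp: prime_gt_0_nat)
  have "inverse (of_nat p) \<notin> (\<int> :: complex set)"
  proof
    assume "inverse (of_nat p) \<in> (\<int> :: complex set)"
    then obtain k where "inverse (of_nat p) = (of_int k :: complex)" by (elim Ints_cases)
    then have "of_int (k * int p) = (1 :: complex)" using p1 by (simp add: field_simps)
    then have "k * int p = 1" using of_int_eq_1_iff by blast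
    then show False using p1 by (metis dvd_triv_right int_dvd_int_iff nat_dvd_1_iff_1 of_nat_1 order_less_irrefl)
  qed
  then obtain V where V: "unital_subring V" "inverse (of_nat p) \<notin> V"
    "\<And>S. unital_subring S \<Longrightarrow> V \<subset> S \<Longrightarrow> inverse (of_nat p :: complex) \<in> S"
    using maximal_subring_avoiding[OF Z] by blast
  have "x \<in> V \<or> inverse x \<in> V" for x
    by (rule maximal_subring_valuation[of V "of_nat p"])
      (use V p1 in \<open>auto intro: unital_subring.of_nat_closed\<close>)
  then show ?thesis using V assms by (intro that[of V] place.intro place_axioms.intro) auto
qed

section \<open>Totally ramified local rings without completion\<close>

text \<open>\<open>B\<close> is the ring of coefficients of the unramified part, \<open>A\<close> represents its residue field, and
  \<open>\<pi> ^ e = p * w\<close> makes \<open>\<pi>\<close> a uniformizer of ramification index \<open>e\<close>. The closure \<open>C\<close> of \<open>B[\<pi>]\<close>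
  is saturated in \<open>V\<close> only once the unit \<open>w\<close> is known to lie in it.\<close>

locale totally_ramified = place +
  fixes B A :: "complex set" and \<pi> w :: complex and e :: nat
  assumes B: "unital_subring B" "B \<subseteq> V" and A: "A \<subseteq> B"
    and B_mod: "b \<in> B \<Longrightarrow> \<exists>a\<in>A. \<exists>b'\<in>B. b = a + of_nat p * b'"
    and A_inverse: "a \<in> A \<Longrightarrow> a = 0 \<or> (\<exists>u\<in>B. \<exists>b\<in>B. u * a = 1 + of_nat p * b)"
    and \<pi>: "\<pi> \<in> M" and e: "e > 0" and w: "w \<in> V" "w \<notin> M" and \<pi>_power: "\<pi> ^ e = of_nat p * w"
begin

text \<open>The value group of \<open>V\<close> is divisible, so \<open>M\<close> properly contains
  \<open>J 1\<close>: it holds a square root of \<open>\<pi>\<close>. Iterations gain precision only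
  from factors in \<open>J 1\<close>, hence the care to reach \<open>J 1\<close> and not just
  \<open>M\<close>; \<open>C_M_J\<close> closes the gap for elements of \<open>C\<close>.\<close>

definition J :: "nat \<Rightarrow> complex set" where "J N = {\<pi> ^ N * r | r. r \<in> V}"

definition G :: "complex set" where "G = {poly f \<pi> | f. \<forall>i. coeff f i \<in> B}"

text \<open>Approximation is measured inside \<open>V\<close>, and whatever lies in every
  \<open>J N\<close> belongs to \<open>C\<close>. Limits are never constructed, so their uniqueness
  does not enter.\<close>

definition C :: "complex set" where "C = {z \<in> V. \<forall>N. \<exists>g\<in>G. z - g \<in> J N}"

lemma \<pi>_nz: "\<pi> \<noteq> 0"
  using \<pi>_power e not_M_nz[OF w(2)] prime_gt_0_nat[OF prime_p] by (auto simp: power_0_left)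

lemma B_V: "b \<in> B \<Longrightarrow> b \<in> V" using B by auto

lemma J_0: "x \<in> V \<Longrightarrow> x \<in> J 0" by (auto simp: J_def)

lemma J_zero: "0 \<in> J N" 
  unfolding J_def by (rule CollectI, rule exI[of _ 0]) (simp add: zero_closed)

lemma J_add: "x \<in> J N \<Longrightarrow> y \<in> J N \<Longrightarrow> x + y \<in> J N"
  unfolding J_def by (auto simp flip: distrib_left intro: add_closed)

lemma J_uminus: "x \<in> J N \<Longrightarrow> - x \<in> J N"
  unfolding J_def by (auto simp flip: mult_minus_right intro: uminus_closed)

lemma J_diff: "x \<in> J N \<Longrightarrow> y \<in> J N \<Longrightarrow> x - y \<in> J N"
  using J_add[OF _ J_uminus, of x N y] by simp

lemma J_mult: "x \<in> J N \<Longrightarrow> y \<in> J K \<Longrightarrow> x * y \<in> J (N + K)"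
proof -
  assume "x \<in> J N" "y \<in> J K"
  then obtain r s where "x = \<pi> ^ N * r" "y = \<pi> ^ K * s" "r \<in> V" "s \<in> V" by (auto simp: J_def)
  then have "x * y = \<pi> ^ (N + K) * (r * s)" "r * s \<in> V" by (auto simp: power_add intro: closed)
  then show ?thesis by (auto simp: J_def)
qed

lemma J_mult_V: "x \<in> J N \<Longrightarrow> y \<in> V \<Longrightarrow> x * y \<in> J N"
  using J_mult[of x N y 0] J_0 by simp

lemma J_V_mult: "y \<in> V \<Longrightarrow> x \<in> J N \<Longrightarrow> y * x \<in> J N"
  using J_mult_V[of x N y] by (simp add: mult.commute)

lemma J_Suc_mult: "x \<in> J N \<Longrightarrow> y \<in> J 1 \<Longrightarrow> x * y \<in> J (Suc N)"
  using J_mult[of x N y 1] by simp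

lemma J_mono: "x \<in> J N \<Longrightarrow> K \<le> N \<Longrightarrow> x \<in> J K"
proof -
  assume "x \<in> J N" "K \<le> N"
  then obtain r where r: "x = \<pi> ^ N * r" "r \<in> V" by (auto simp: J_def)
  have "\<pi> ^ N = \<pi> ^ K * \<pi> ^ (N - K)" using \<open>K \<le> N\<close> by (simp flip: power_add)
  then have "x = \<pi> ^ K * (\<pi> ^ (N - K) * r)" using r by simp
  moreover have "\<pi> ^ (N - K) * r \<in> V" using r \<pi> M_V by (intro closed) auto
  ultimately show ?thesis by (auto simp: J_def)
qed

lemma J_1_M: "x \<in> J 1 \<Longrightarrow> x \<in> M"
  using \<pi> M_mult' by (auto simp: J_def)

lemma p_J: "of_nat p \<in> J 1"
proof -
  have "of_nat p = \<pi> ^ e * inverse w" using \<pi>_power not_M_nz[OF w(2)] by simp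
  then have "of_nat p \<in> J e" unfolding J_def using inverse_closed[OF w] by auto
  then show ?thesis by (rule J_mono) (use e in simp)
qed

lemma G_subring: "unital_subring G"
  unfolding G_def by (rule unital_subring.adjoin_subring[OF B(1)])

lemma B_G: "b \<in> B \<Longrightarrow> b \<in> G"
  unfolding G_def using unital_subring.zero_closed[OF B(1)]
  by (intro CollectI exI[of _ "[:b:]"]) (auto simp: coeff_pCons split: nat.splits)

lemma \<pi>_G: "\<pi> \<in> G"
  unfolding G_def using unital_subring.zero_closed[OF B(1)] unital_subring.one_closed[OF B(1)]
  by (intro CollectI exI[of _ "[:0,1:]"]) (auto simp: coeff_pCons split: nat.splits)

lemma G_decomp:
  assumes "g \<in> G" obtains b g' where "b \<in> B" "g' \<in> G" "g = b + \<pi> * g'"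
proof -
  obtain f where f: "g = poly f \<pi>" "\<forall>i. coeff f i \<in> B" using assms by (auto simp: G_def)
  obtain b f' where f': "f = pCons b f'" by (rule pCons_cases)
  have "b \<in> B" using f(2) f' by (auto dest: spec[of _ 0])
  moreover have "\<forall>i. coeff f' i \<in> B" using f(2) f' by (metis coeff_pCons_Suc)
  then have "poly f' \<pi> \<in> G" by (auto simp: G_def)
  moreover have "g = b + \<pi> * poly f' \<pi>" using f f' by simp
  ultimately show ?thesis using that by blast
qed

lemma G_V: "g \<in> G \<Longrightarrow> g \<in> V"
  unfolding G_def using B_V \<pi> M_V by (auto intro: poly_closed)

lemma C_V: "x \<in> C \<Longrightarrow> x \<in> V" by (simp add: C_def)

lemma G_C: "x \<in> G \<Longrightarrow> x \<in> C"
  using G_V J_zero by (auto simp: C_def intro!: bexI[of _ x])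

lemma C_closed:
  assumes "z \<in> V" "\<And>N. \<exists>c\<in>C. z - c \<in> J N" shows "z \<in> C"
proof -
  have "\<exists>g\<in>G. z - g \<in> J N" for N
  proof -
    obtain c where c: "c \<in> C" "z - c \<in> J N" using assms by blast
    then obtain g where g: "g \<in> G" "c - g \<in> J N" by (auto simp: C_def)
    have "z - g \<in> J N" using J_add[OF c(2) g(2)] by simp
    with g show ?thesis by blast
  qed
  with assms(1) show ?thesis by (auto simp: C_def)
qed

lemma C_subring: "unital_subring C"
proof
  show "1 \<in> C" by (intro G_C unital_subring.one_closed G_subring)
next
  fix x y assume xy: "x \<in> C" "y \<in> C"
  have "\<exists>g\<in>G. (x - y) - g \<in> J N \<and> (\<exists>h\<in>G. x * y - h \<in> J N)" for N
  proof -
    obtain g where g: "g \<in> G" "x - g \<in> J N" using xy(1) by (auto simp: C_def)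
    obtain h where h: "h \<in> G" "y - h \<in> J N" using xy(2) by (auto simp: C_def)
    have "(x - y) - (g - h) \<in> J N" using J_diff[OF g(2) h(2)] by (simp add: algebra_simps)
    moreover have "x * y - g * h \<in> J N"
      using J_add[OF J_mult_V[OF g(2), of y] J_V_mult[OF _ h(2), of g]] xy(2) C_V G_V[OF g(1)]
      by (simp add: algebra_simps)
    moreover have "g - h \<in> G" "g * h \<in> G"
      using g h G_subring unital_subring.diff_closed unital_subring.mult_closed by blast+
    ultimately show ?thesis by blast
  qed
  then show "x - y \<in> C" "x * y \<in> C" using xy by (auto simp: C_def intro: closed)
qed

sublocale C: unital_subring C by (rule C_subring)

lemma \<pi>_C: "\<pi> \<in> C" by (intro G_C \<pi>_G)

lemma B_C: "b \<in> B \<Longrightarrow> b \<in> C" by (intro G_C B_G)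

text \<open>Plays the role of Hensel's lemma. The solution \<open>x\<close> already exists in
  \<open>V\<close>; only its membership in \<open>C\<close> is at stake, and the iterates of
  \<open>T\<close> starting at \<open>a\<close> approximate it.\<close>

lemma contraction_fixpoint:
  assumes "x \<in> V" "a \<in> C" "x - a \<in> J 1" and T: "\<And>z. z \<in> C \<Longrightarrow> T z \<in> C"
    and contr: "\<And>z N. z \<in> C \<Longrightarrow> N \<ge> 1 \<Longrightarrow> x - z \<in> J N \<Longrightarrow> x - T z \<in> J (Suc N)"
  shows "x \<in> C"
proof (rule C_closed)
  fix N
  have "\<exists>c\<in>C. x - c \<in> J (Suc N)"
  proof (induction N)
    case 0 then show ?case using assms by auto
  next
    case (Suc N) then show ?case using T contr[of _ "Suc N"] by auto
  qed
  then show "\<exists>c\<in>C. x - c \<in> J N" using J_mono by (meson le_SucI order_refl)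
qed fact

lemma residue_J:
  assumes "x \<in> C" obtains a where "a \<in> A" "x - a \<in> J 1"
proof -
  obtain g where g: "g \<in> G" "x - g \<in> J 1" using assms by (auto simp: C_def)
  obtain b g' where b: "b \<in> B" "g' \<in> G" "g = b + \<pi> * g'" by (rule G_decomp[OF g(1)])
  obtain a b' where a: "a \<in> A" "b' \<in> B" "b = a + of_nat p * b'" using B_mod[OF b(1)] by blast
  have "\<pi> * g' \<in> J 1" using b(2) G_V by (auto simp: J_def)
  moreover have "of_nat p * b' \<in> J 1" using p_J a(2) B_V J_mult_V by blast
  moreover have "x - a = (x - g) + \<pi> * g' + of_nat p * b'" using a b by simp
  ultimately have "x - a \<in> J 1" using g(2) J_add by presburger
  with a that show ?thesis by blast
qed

lemma A_M: "a \<in> A \<Longrightarrow> a \<in> M \<Longrightarrow> a = 0"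
proof (rule ccontr)
  assume a: "a \<in> A" "a \<in> M" "a \<noteq> 0"
  then obtain u b where ub: "u \<in> B" "b \<in> B" "u * a = 1 + of_nat p * b" using A_inverse by blast
  then have "1 = u * a - of_nat p * b" by simp
  also have "\<dots> \<in> M" using ub a B_V p_M by (intro M_diff M_mult M_mult') auto
  finally show False using one_not_M by simp
qed

text \<open>Started from an inverse \<open>u\<close> of the residue, replacing \<open>z\<close> by
  \<open>z + u * (1 - x * z)\<close> multiplies the error by \<open>1 - u * x\<close>, which lies in
  \<open>J 1\<close>.\<close>

lemma inverse_C:
  assumes x: "x \<in> C" "x \<notin> M" shows "inverse x \<in> C"
proof -
  obtain a where a: "a \<in> A" "x - a \<in> J 1" by (rule residue_J[OF x(1)])
  have "a \<noteq> 0" using a x J_1_M by auto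
  then obtain u b where ub: "u \<in> B" "b \<in> B" "u * a = 1 + of_nat p * b" using A_inverse a by blast
  have nz: "x \<noteq> 0" using x not_M_nz by blast
  have iv: "inverse x \<in> V" using inverse_closed x C_V by blast
  have uC: "u \<in> C" "u \<in> V" using ub B_C B_V by auto
  have "1 - u * x = - (u * (x - a)) - of_nat p * b" using ub(3) by (simp add: algebra_simps)
  also have "\<dots> \<in> J 1" using a(2) uC ub B_V
    by (intro J_diff J_uminus J_V_mult[OF _ a(2)] J_mult_V[OF p_J]) auto
  finally have ux: "1 - u * x \<in> J 1" .
  show ?thesis
  proof (rule contraction_fixpoint[where T = "\<lambda>z. z + u * (1 - x * z)" and a = u])
    have "inverse x - u = inverse x * (1 - u * x)" using nz by (simp add: field_simps)
    then show "inverse x - u \<in> J 1" using J_V_mult[OF iv ux] by simp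
  next
    fix z N assume "inverse x - z \<in> J N"
    moreover have "inverse x - (z + u * (1 - x * z)) = (inverse x - z) * (1 - u * x)"
      using nz by (simp add: field_simps)
    ultimately show "inverse x - (z + u * (1 - x * z)) \<in> J (Suc N)" using J_Suc_mult ux by metis
  qed (use iv uC x in \<open>auto intro!: C.closed\<close>)
qed

section \<open>Saturation of the closure in the valuation ring\<close>

context
  assumes wC: "w \<in> C"
begin

text \<open>Makes \<open>\<pi>\<close> a uniformizer of \<open>C\<close>. An approximation of
  \<open>z\<close> is divided by \<open>\<pi>\<close> term by term: the digit in \<open>A\<close> of
  its constant term must vanish, and the rest of that term is a multiple of
  \<open>p = \<pi> * \<tau>\<close>. Here \<open>w \<in> C\<close> enters, to put
  \<open>\<tau>\<close> in \<open>C\<close>.\<close>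

lemma C_M:
  assumes z: "z \<in> C" "z \<in> M" obtains z' where "z' \<in> C" "z = \<pi> * z'"
proof -
  have w0: "w \<noteq> 0" using w not_M_nz by blast
  define \<tau> where "\<tau> = \<pi> ^ (e - 1) * inverse w"
  have \<tau>: "\<tau> \<in> C" unfolding \<tau>_def by (intro C.closed \<pi>_C inverse_C wC w)
  have p\<tau>: "of_nat p = \<pi> * \<tau>"
    using \<pi>_power e w0 unfolding \<tau>_def by (cases e) (auto simp: field_simps)
  obtain a where a: "a \<in> A" "z - a \<in> J 1" by (rule residue_J[OF z(1)])
  have "a \<in> M" using M_diff[OF z(2) J_1_M[OF a(2)]] by simp
  then have "a = 0" using A_M a by blast
  then obtain z' where z': "z = \<pi> * z'" "z' \<in> V" using a by (auto simp: J_def)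
  have "z' \<in> C"
  proof (rule C_closed)
    fix N
    obtain g where g: "g \<in> G" "z - g \<in> J (Suc N)" using z by (auto simp: C_def)
    obtain b g' where b: "b \<in> B" "g' \<in> G" "g = b + \<pi> * g'" by (rule G_decomp[OF g(1)])
    obtain a b' where a: "a \<in> A" "b' \<in> B" "b = a + of_nat p * b'" using B_mod[OF b(1)] by blast
    obtain r where r: "z - g = \<pi> ^ Suc N * r" "r \<in> V" using g(2) unfolding J_def by auto
    have "a = \<pi> * (z' - g' - \<tau> * b' - \<pi> ^ N * r)"
      using a(3) b(3) r(1) z'(1) p\<tau> by (simp add: algebra_simps)
    moreover have "z' - g' - \<tau> * b' - \<pi> ^ N * r \<in> V"
      using z' b a \<tau> C_V G_V B_V \<pi> M_V r by (intro closed) auto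
    ultimately have "a \<in> M" using M_mult' \<pi> by metis
    then have "a = 0" using A_M a by blast
    with \<open>a = \<pi> * _\<close> have "z' - g' - \<tau> * b' - \<pi> ^ N * r = 0" using \<pi>_nz by simp
    then have "z' - (g' + \<tau> * b') = \<pi> ^ N * r" by (simp add: algebra_simps)
    moreover have "g' + \<tau> * b' \<in> C" using G_C b B_C a \<tau> by (intro C.closed) auto
    ultimately show "\<exists>c\<in>C. z' - c \<in> J N" using r by (auto simp: J_def)
  qed fact
  with z' that show ?thesis by blast
qed

lemma C_M_J: "z \<in> C \<Longrightarrow> z \<in> M \<Longrightarrow> z \<in> J 1"
  by (erule (1) C_M) (auto simp: J_def C_V)

lemma saturated_\<pi>: "y \<in> V \<Longrightarrow> \<pi> ^ k * y \<in> C \<Longrightarrow> y \<in> C"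
proof (induction k)
  case (Suc k)
  have V: "\<pi> ^ k * y \<in> V" using \<pi> M_V Suc by (intro closed) auto
  have e: "\<pi> ^ Suc k * y = \<pi> * (\<pi> ^ k * y)" by simp
  have "\<pi> ^ Suc k * y \<in> M" unfolding e using M_mult'[OF \<pi> V] .
  then obtain z' where "z' \<in> C" "\<pi> ^ Suc k * y = \<pi> * z'" using C_M Suc by metis
  then show ?case using Suc \<pi>_nz e by auto
qed simp

lemma saturated_p: "y \<in> V \<Longrightarrow> of_nat p * y \<in> C \<Longrightarrow> y \<in> C"
proof -
  assume y: "y \<in> V" "of_nat p * y \<in> C"
  have "\<pi> ^ e * y = w * (of_nat p * y)" using \<pi>_power by simp
  then have "\<pi> ^ e * y \<in> C" using y wC C.mult_closed by metis
  then show ?thesis using y saturated_\<pi> by blast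
qed

lemma saturated_int: "k \<noteq> 0 \<Longrightarrow> y \<in> V \<Longrightarrow> of_int k * y \<in> C \<Longrightarrow> y \<in> C"
proof (induction "nat \<bar>k\<bar>" arbitrary: k rule: less_induct)
  case less
  show ?case
  proof (cases "int p dvd k")
    case True
    then obtain l where l: "k = int p * l" by auto
    have "nat \<bar>l\<bar> < nat \<bar>k\<bar>" using l less.prems prime_gt_1_nat[OF prime_p] by (simp add: abs_mult)
    moreover have "of_int l * y \<in> C"
    proof (rule saturated_p)
      show "of_int l * y \<in> V" using less.prems by (intro closed)
      show "of_nat p * (of_int l * y) \<in> C" using less.prems l by (simp add: mult.assoc)
    qed
    moreover have "l \<noteq> 0" using l less.prems by auto
    ultimately show ?thesis using less by blast
  next
    case False
    then have "inverse (of_int k) \<in> C" using M_of_int_iff by (intro inverse_C C.closed) auto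
    from C.mult_closed[OF this less.prems(3)] show ?thesis using less.prems by (simp flip: mult.assoc)
  qed
qed

text \<open>Clearing denominators puts a nonzero integer multiple of the value in \<open>C\<close>,
  and saturation removes the integer. This bounds the residues of Q(x) without describing its ring
  of integers.\<close>

lemma residue_poly:
  assumes x: "x \<in> C" and V: "poly (map_poly of_rat f) x \<in> V"
  shows "\<exists>a\<in>A. poly (map_poly of_rat f) x - a \<in> M"
proof -
  have "\<exists>k::int. k \<noteq> 0 \<and> of_int k * poly (map_poly of_rat f) x \<in> C"
  proof (induction f)
    case 0 then show ?case by (auto intro!: exI[of _ 1] C.closed)
  next
    case (pCons q f)
    obtain k :: int where k: "k \<noteq> 0" "of_int k * poly (map_poly of_rat f) x \<in> C" using pCons by blast
    obtain n d where q: "quotient_of q = (n, d)" by fastforce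
    have d: "d > 0" "q = of_int n / of_int d"
      using quotient_of_denom_pos[OF q] quotient_of_div[OF q] by auto
    have qd: "of_int d * of_rat q = (of_int n :: complex)" using d by (simp add: of_rat_divide)
    have "of_int (d * k) * poly (map_poly of_rat (pCons q f)) x
        = of_int k * (of_int d * of_rat q) + of_int d * x * (of_int k * poly (map_poly of_rat f) x)"
      using pCons.hyps by (simp add: map_poly_pCons algebra_simps)
    also have "\<dots> \<in> C" unfolding qd
      by (intro C.add_closed[OF C.mult_closed[OF C.of_int_closed C.of_int_closed]]
          C.mult_closed[OF C.mult_closed[OF C.of_int_closed x] k(2)])
    finally show ?case using k d by (intro exI[of _ "d * k"]) auto
  qed
  then have "poly (map_poly of_rat f) x \<in> C" using saturated_int V by blast
  then obtain a where "a \<in> A" "poly (map_poly of_rat f) x - a \<in> J 1" by (rule residue_J)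
  then show ?thesis using J_1_M by blast
qed

end

end

section \<open>A criterion for non-monogenicity\<close>

abbreviation ratpoly :: "rat poly \<Rightarrow> complex \<Rightarrow> complex" where
  "ratpoly f x \<equiv> poly (map_poly of_rat f) x"

abbreviation intpoly :: "int poly \<Rightarrow> complex \<Rightarrow> complex" where
  "intpoly f x \<equiv> poly (map_poly of_int f) x"

lemma ratpoly_pCons: "ratpoly (pCons a f) x = of_rat a + x * ratpoly f x"
  by (cases "a = 0 \<and> f = 0") (auto simp: map_poly_pCons)

lemma ratpoly_add: "ratpoly (f + g) x = ratpoly f x + ratpoly g x"
proof -
  have "map_poly of_rat (f + g) = map_poly of_rat f + (map_poly of_rat g :: complex poly)"
    by (rule poly_eqI) (simp add: coeff_map_poly of_rat_add)
  then show ?thesis by simp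
qed

lemma ratpoly_smult: "ratpoly (smult a f) x = of_rat a * ratpoly f x"
proof -
  have "map_poly of_rat (smult a f) = smult (of_rat a) (map_poly of_rat f :: complex poly)"
    by (rule poly_eqI) (simp add: coeff_map_poly of_rat_mult)
  then show ?thesis by simp
qed

lemma ratpoly_mult: "ratpoly (f * g) x = ratpoly f x * ratpoly g x"
  by (induction f) (auto simp: ratpoly_pCons ratpoly_add ratpoly_smult algebra_simps)

lemma ratpoly_uminus: "ratpoly (- f) x = - ratpoly f x"
  using ratpoly_smult[of "-1" f x] by simp

lemma ratpoly_diff: "ratpoly (f - g) x = ratpoly f x - ratpoly g x"
  using ratpoly_add[of f "- g" x] by (simp add: ratpoly_uminus)

lemma ratpoly_const: "ratpoly [:a:] x = of_rat a"
  by (simp add: ratpoly_pCons)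

lemma ratpoly_pcompose: "ratpoly (pcompose f g) x = ratpoly f (ratpoly g x)"
  by (induction f) (auto simp: ratpoly_pCons ratpoly_add ratpoly_mult ratpoly_const pcompose_pCons)

lemma ratpoly_monom: "ratpoly (monom a n) x = of_rat a * x ^ n"
  by (induction n) (auto simp: monom_0 monom_Suc ratpoly_pCons ratpoly_const)

lemma ratpoly_of_int: "ratpoly (map_poly of_int f) x = intpoly f x"
proof -
  have "map_poly of_rat (map_poly of_int f) = (map_poly of_int f :: complex poly)"
    by (rule poly_eqI) (simp add: coeff_map_poly)
  then show ?thesis by simp
qed

lemma intpoly_pCons: "intpoly (pCons a f) x = of_int a + x * intpoly f x"
  by (cases "a = 0 \<and> f = 0") (auto simp: map_poly_pCons)

section \<open>Conjugates and the field generated by one root\<close>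

lemma irreducible_dvd_if_common_root:
  assumes "Factorial_Ring.irreducible F" "ratpoly F x = 0" "ratpoly g x = 0"
  shows "F dvd g"
proof -
  have "\<not> is_unit (gcd F g)"
  proof
    assume "is_unit (gcd F g)"
    then have "gcd F g = 1" using is_unit_gcd_iff by blast
    then obtain a b where "a * F + b * g = 1" by (metis bezout_coefficients_fst_snd)
    then have "ratpoly (a * F + b * g) x = 1" using ratpoly_const[of 1 x] by (simp add: one_pCons)
    then show False using assms by (simp add: ratpoly_add ratpoly_mult)
  qed
  then have "F dvd gcd F g" using irreducibleD'[OF assms(1), of "gcd F g"] by simp
  then show ?thesis by (metis dvd_trans gcd_dvd2)
qed

lemma algebraic_int_root_monom:
  assumes "F = Polynomial.monom 1 n - [:of_int m:]" "n > 0" "ratpoly F \<alpha> = 0"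
  shows "algebraic_int \<alpha>"
proof (rule algebraic_int_root[of "of_int m" "monom 1 n"])
  show "poly (monom 1 n) \<alpha> = of_int m"
    using assms by (simp add: ratpoly_diff ratpoly_monom ratpoly_const poly_monom)
qed (use assms in \<open>auto simp: degree_monom_eq\<close>)

text \<open>The field embedding that sends \<open>x\<close> to \<open>y\<close>, expressed through
  polynomials: relations over the rationals pass between conjugates, so no embedding has to be
  constructed.\<close>

lemma conjugate_root:
  assumes "Factorial_Ring.irreducible F" "ratpoly F x = 0" "ratpoly F y = 0" "ratpoly g x = 0"
  shows "ratpoly g y = 0"
  using irreducible_dvd_if_common_root[OF assms(1,2,4)] assms(3) by (auto simp: ratpoly_mult)

lemma algebraic_int_conjugate:
  assumes F: "Factorial_Ring.irreducible F" "ratpoly F x = 0" "ratpoly F y = 0"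
    and "algebraic_int (ratpoly g x)"
  shows "algebraic_int (ratpoly g y)"
proof -
  obtain q where q: "intpoly q (ratpoly g x) = 0" "lead_coeff q = 1"
    using assms(4) unfolding algebraic_int_altdef_ipoly by auto
  have "ratpoly (pcompose (map_poly of_int q) g) x = 0"
    unfolding ratpoly_pcompose ratpoly_of_int by (fact q)
  from conjugate_root[OF F this] have "intpoly q (ratpoly g y) = 0"
    unfolding ratpoly_pcompose ratpoly_of_int .
  with q show ?thesis unfolding algebraic_int_altdef_ipoly by blast
qed

lemma ring_of_type_algebra_inv:
  "x \<noteq> 0 \<Longrightarrow> inv\<^bsub>ring_of_type_algebra\<^esub> x = inverse (x :: complex)"
proof -
  interpret R: field "ring_of_type_algebra :: complex ring" by (rule field_from_type_algebra)
  assume "x \<noteq> 0"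
  then show ?thesis
    by (intro R.inv_unique'[symmetric]) (auto simp: ring_of_type_algebra_def)
qed

lemma rat_adjoin_algebraic:
  assumes F: "Factorial_Ring.irreducible F" "ratpoly F \<alpha> = 0"
  shows "rat_adjoin \<alpha> = range (\<lambda>f. ratpoly f \<alpha>)"
proof
  show "rat_adjoin \<alpha> \<subseteq> range (\<lambda>f. ratpoly f \<alpha>)"
  proof
    fix x assume "x \<in> rat_adjoin \<alpha>"
    then show "x \<in> range (\<lambda>f. ratpoly f \<alpha>)" unfolding rat_adjoin_def
    proof (induction rule: generate_field.induct)
      case one
      then show ?case
        by (intro image_eqI[of _ _ 1]) (auto simp: ring_of_type_algebra_def)
    next
      case (incl h)
      then show ?case by (intro image_eqI[of _ _ "[:0,1:]"]) (auto simp: ratpoly_pCons)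
    next
      case (a_inv h)
      interpret R: field "ring_of_type_algebra :: complex ring" by (rule field_from_type_algebra)
      have "\<ominus>\<^bsub>ring_of_type_algebra\<^esub> h = - h"
        by (intro R.minus_equality) (auto simp: ring_of_type_algebra_def)
      with a_inv show ?case by (metis (no_types, lifting) image_iff rangeI ratpoly_uminus)
    next
      case (m_inv h)
      then obtain g where g: "h = ratpoly g \<alpha>" by auto
      have nz: "h \<noteq> 0" using m_inv by (simp add: ring_of_type_algebra_def)
      \<comment> \<open>Bezout with the irreducible \<open>F\<close> turns the inverse into a
        polynomial in \<open>\<alpha>\<close>.\<close>
      then have "\<not> F dvd g" using g F by (auto simp: ratpoly_mult)
      then have "\<not> F dvd gcd F g" by (metis dvd_trans gcd_dvd2)
      then have "gcd F g = 1" using irreducibleD'[OF F(1), of "gcd F g"] is_unit_gcd_iff by auto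
      then obtain a b where "a * F + b * g = 1" by (metis bezout_coefficients_fst_snd)
      then have "ratpoly (a * F + b * g) \<alpha> = 1" using ratpoly_const[of 1 \<alpha>] by (simp add: one_pCons)
      then have "ratpoly b \<alpha> * h = 1" using F g by (simp add: ratpoly_add ratpoly_mult)
      then have "inverse h = ratpoly b \<alpha>" using nz by (simp add: field_simps)
      then show ?case using ring_of_type_algebra_inv[OF nz] by auto
    next
      case (eng_add h1 h2)
      then show ?case
        by (auto simp: ring_of_type_algebra_def simp flip: ratpoly_add)
    next
      case (eng_mult h1 h2)
      then show ?case
        by (auto simp: ring_of_type_algebra_def simp flip: ratpoly_mult)
    qed
  qed
next
  let ?R = "ring_of_type_algebra :: complex ring"
  have add: "x + y \<in> rat_adjoin \<alpha>" if "x \<in> rat_adjoin \<alpha>" "y \<in> rat_adjoin \<alpha>" for x y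
    using generate_field.eng_add[of x ?R "{\<alpha>}" y] that
    by (simp add: rat_adjoin_def ring_of_type_algebra_def)
  have mult: "x * y \<in> rat_adjoin \<alpha>" if "x \<in> rat_adjoin \<alpha>" "y \<in> rat_adjoin \<alpha>" for x y
    using generate_field.eng_mult[of x ?R "{\<alpha>}" y] that
    by (simp add: rat_adjoin_def ring_of_type_algebra_def)
  have inv: "inverse x \<in> rat_adjoin \<alpha>" if "x \<in> rat_adjoin \<alpha>" for x
    using generate_field.m_inv[of x ?R "{\<alpha>}"] that ring_of_type_algebra_inv[of x]
    by (cases "x = 0") (auto simp: rat_adjoin_def ring_of_type_algebra_def)
  have one: "1 \<in> rat_adjoin \<alpha>"
    using generate_field.one[of ?R "{\<alpha>}"] by (simp add: rat_adjoin_def ring_of_type_algebra_def)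
  interpret R: field ?R by (rule field_from_type_algebra)
  have "\<ominus>\<^bsub>?R\<^esub> 1 = - 1"
    by (intro R.minus_equality) (auto simp: ring_of_type_algebra_def)
  then have neg: "- 1 \<in> rat_adjoin \<alpha>"
    using generate_field.a_inv[of 1 ?R "{\<alpha>}"] one by (simp add: rat_adjoin_def)
  have \<alpha>: "\<alpha> \<in> rat_adjoin \<alpha>" by (simp add: rat_adjoin_def generate_field.incl)
  have zero: "0 \<in> rat_adjoin \<alpha>" using add[OF one neg] by simp
  have nat: "of_nat n \<in> rat_adjoin \<alpha>" for n by (induction n) (auto intro: zero one add)
  have int: "of_int k \<in> rat_adjoin \<alpha>" for k
    using nat mult[OF neg nat] by (cases k rule: int_cases2) auto
  have rat: "of_rat q \<in> rat_adjoin \<alpha>" for q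
  proof -
    obtain n d where "quotient_of q = (n, d)" by fastforce
    then have "q = of_int n / of_int d" by (rule quotient_of_div)
    then have "of_rat q = of_int n * inverse (of_int d :: complex)"
      by (simp add: of_rat_mult of_rat_inverse divide_inverse)
    then show ?thesis using mult int inv by simp
  qed
  have "ratpoly f \<alpha> \<in> rat_adjoin \<alpha>" for f
    by (induction f) (auto simp: ratpoly_pCons intro!: add mult zero rat \<alpha>)
  then show "range (\<lambda>f. ratpoly f \<alpha>) \<subseteq> rat_adjoin \<alpha>" by auto
qed

lemma int_span_powers:
  assumes "x \<in> Modules.module.span int_scale (set (map (\<lambda>i. \<theta> ^ i) [0..<n]))"
  obtains c where "x = intpoly c \<theta>"
proof -
  interpret Modules.module int_scale by (rule module_int_scale)
  from assms have "\<exists>c. x = intpoly c \<theta>"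
  proof (induction rule: span_induct_alt)
    case base
    then show ?case by (intro exI[of _ 0]) auto
  next
    case (step k b y)
    then obtain i c where ic: "b = \<theta> ^ i" "y = intpoly c \<theta>" by auto
    have e: "map_poly of_int (monom k i + c) = monom (of_int k) i + (map_poly of_int c :: complex poly)"
      by (rule poly_eqI) (simp add: coeff_map_poly)
    show ?case unfolding int_scale_def ic
      by (intro exI[of _ "monom k i + c"]) (simp add: e poly_monom)
  qed
  with that show ?thesis by blast
qed

section \<open>Counting residues of conjugates\<close>

lemma (in place) intpoly_congruent:
  assumes "x \<in> V" "y \<in> V" "x - y \<in> M"
  shows "intpoly c x - intpoly c y \<in> M"
proof (induction c)
  case (pCons a c)
  have "intpoly (pCons a c) x - intpoly (pCons a c) y
      = x * (intpoly c x - intpoly c y) + (x - y) * intpoly c y"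
    by (simp add: intpoly_pCons algebra_simps)
  moreover have "intpoly c y \<in> V"
    using assms by (intro poly_closed) (auto simp: coeff_map_poly closed)
  ultimately show ?case using assms pCons M_add M_mult M_mult' by presburger
qed (simp add: zero_M)

text \<open>Pigeonhole on the residues of the conjugates \<open>ratpoly g (r i)\<close> of a
  generator. A collision is passed on to every integer polynomial in the generator, and the
  separating element \<open>ratpoly h \<alpha>\<close> is one of these.\<close>

lemma (in place) not_monogenic_if_many_residues:
  fixes r :: "'i \<Rightarrow> complex"
  assumes F: "Factorial_Ring.irreducible F" "ratpoly F \<alpha> = 0"
    and roots: "\<And>i. i \<in> I \<Longrightarrow> ratpoly F (r i) = 0"
    and card: "finite A" "card A < card I"
    and residue: "\<And>i g. i \<in> I \<Longrightarrow> ratpoly g (r i) \<in> V \<Longrightarrow> \<exists>a\<in>A. ratpoly g (r i) - a \<in> M"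
    and separate: "\<And>i j. i \<in> I \<Longrightarrow> j \<in> I \<Longrightarrow> i \<noteq> j \<Longrightarrow>
      \<exists>h. algebraic_int (ratpoly h \<alpha>) \<and> ratpoly h (r i) - ratpoly h (r j) \<notin> M"
  shows "\<not> monogenic (rat_adjoin \<alpha>)"
proof
  assume "monogenic (rat_adjoin \<alpha>)"
  then obtain \<theta> n where \<theta>: "\<theta> \<in> rat_adjoin \<alpha>" "algebraic_int \<theta>"
    and span: "Modules.module.span int_scale (set (map (\<lambda>i. \<theta> ^ i) [0..<n])) = ring_of_integers (rat_adjoin \<alpha>)"
    unfolding monogenic_def is_int_basis_def ring_of_integers_def by auto
  obtain g where g: "\<theta> = ratpoly g \<alpha>" using \<theta>(1) unfolding rat_adjoin_algebraic[OF F] by auto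
  have gV: "ratpoly g (r i) \<in> V" if "i \<in> I" for i
    using algebraic_int_conjugate[OF F roots[OF that]] \<theta>(2) g algebraic_int_closed by blast
  define a where "a = (\<lambda>i. SOME a. a \<in> A \<and> ratpoly g (r i) - a \<in> M)"
  have a: "a i \<in> A" "ratpoly g (r i) - a i \<in> M" if "i \<in> I" for i
  proof -
    have "\<exists>a. a \<in> A \<and> ratpoly g (r i) - a \<in> M" using residue[OF that gV[OF that]] by blast
    from someI_ex[OF this] show "a i \<in> A" "ratpoly g (r i) - a i \<in> M" unfolding a_def by auto
  qed
  have "\<not> inj_on a I"
  proof
    assume "inj_on a I"
    then have "card I \<le> card A" using a card(1) by (intro card_inj_on_le) auto
    then show False using card(2) by simp
  qed
  then obtain i j where ij: "i \<in> I" "j \<in> I" "i \<noteq> j" "a i = a j" by (auto simp: inj_on_def)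
  have \<theta>ij: "ratpoly g (r i) - ratpoly g (r j) \<in> M"
    using M_diff[OF a(2)[OF ij(1)] a(2)[OF ij(2)]] ij(4) by simp
  obtain h where h: "algebraic_int (ratpoly h \<alpha>)" "ratpoly h (r i) - ratpoly h (r j) \<notin> M"
    using separate ij by blast
  have "ratpoly h \<alpha> \<in> ring_of_integers (rat_adjoin \<alpha>)"
    using h(1) unfolding ring_of_integers_def rat_adjoin_algebraic[OF F] by auto
  then obtain c where c: "ratpoly h \<alpha> = intpoly c \<theta>" using span int_span_powers by metis
  have "ratpoly (h - pcompose (map_poly of_int c) g) \<alpha> = 0"
    using c g by (simp add: ratpoly_diff ratpoly_pcompose ratpoly_of_int)
  from conjugate_root[OF F roots this]
  have "ratpoly h (r k) = intpoly c (ratpoly g (r k))" if "k \<in> I" for k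
    using that by (simp add: ratpoly_diff ratpoly_pcompose ratpoly_of_int)
  then show False using h(2) intpoly_congruent[OF gV[OF ij(1)] gV[OF ij(2)] \<theta>ij] ij by simp
qed

section \<open>The case 4 | m - 1\<close>

definition \<omega> :: complex where "\<omega> = Complex (- 1 / 2) (sqrt 3 / 2)"

lemma \<omega>_square: "\<omega>\<^sup>2 = - 1 - \<omega>"
  by (simp add: \<omega>_def complex_eq_iff power2_eq_square field_simps)

lemma \<omega>_cube: "\<omega> ^ 3 = 1"
  by (simp add: \<omega>_def complex_eq_iff power3_eq_cube field_simps)

lemma \<omega>_power_mult_3: "3 dvd n \<Longrightarrow> (\<omega> ^ i) ^ n = 1"
proof -
  assume "3 dvd n"
  then obtain k where "n = 3 * k" by auto
  then have "(\<omega> ^ i) ^ n = (\<omega> ^ 3) ^ (i * k)" by (simp add: mult_ac flip: power_mult)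
  then show ?thesis by (simp add: \<omega>_cube)
qed

text \<open>Since \<open>\<omega> ^ (2 * i)\<close> is the complex conjugate of
  \<open>\<omega> ^ i\<close>, the product is the squared side of an equilateral triangle. As 3 is a
  unit at places over 2, distinct cube roots of unity stay distinct modulo \<open>M\<close>.\<close>

lemma \<omega>_power_diff:
  assumes "i \<in> {0, 1, 2}" "j \<in> {0, 1, 2}" "i \<noteq> j"
  shows "(\<omega> ^ i - \<omega> ^ j) * (\<omega> ^ (2 * i) - \<omega> ^ (2 * j)) = 3"
proof -
  have "\<omega> ^ 4 = \<omega>" using \<omega>_cube by (simp add: eval_nat_numeral)
  moreover have "\<omega> * \<omega> = - 1 - \<omega>" using \<omega>_square by (simp add: power2_eq_square)
  moreover have "\<omega> * (\<omega> * \<omega>) = 1" using \<omega>_cube by (simp add: power3_eq_cube mult.assoc)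
  ultimately show ?thesis using assms by (auto simp: algebra_simps power2_eq_square)
qed

definition eisenstein_ints :: "complex set" where
  "eisenstein_ints = {of_int a + of_int b * \<omega> | a b. True}"

lemma eisenstein_ints_subring: "unital_subring eisenstein_ints"
proof
  show "1 \<in> eisenstein_ints"
    unfolding eisenstein_ints_def by (intro CollectI exI[of _ 1] exI[of _ 0]) auto
next
  fix x y assume "x \<in> eisenstein_ints" "y \<in> eisenstein_ints"
  then obtain a b c d where xy: "x = of_int a + of_int b * \<omega>" "y = of_int c + of_int d * \<omega>"
    by (auto simp: eisenstein_ints_def)
  show "x - y \<in> eisenstein_ints" unfolding eisenstein_ints_def xy
    by (intro CollectI exI[of _ "a - c"] exI[of _ "b - d"]) (auto simp: algebra_simps)
  have "x * y = of_int a * of_int c + (of_int a * of_int d + of_int b * of_int c) * \<omega>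
      + of_int b * of_int d * \<omega>\<^sup>2"
    unfolding xy by (simp add: algebra_simps power2_eq_square)
  also have "\<dots> = of_int (a * c - b * d) + of_int (a * d + b * c - b * d) * \<omega>"
    unfolding \<omega>_square by (simp add: algebra_simps)
  finally show "x * y \<in> eisenstein_ints" unfolding eisenstein_ints_def by blast
qed

lemma \<omega>_eisenstein: "\<omega> \<in> eisenstein_ints"
  unfolding eisenstein_ints_def by (intro CollectI exI[of _ 0] exI[of _ 1]) auto

text \<open>The residue of \<open>\<omega>\<^sup>2\<close> is represented by
  \<open>1 + \<omega>\<close>, to agree with reducing both coordinates modulo 2.\<close>

definition F4_reps :: "complex set" where "F4_reps = {0, 1, \<omega>, 1 + \<omega>}"

section \<open>Expansions of powers of \<open>1 + z\<close>\<close>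

context unital_subring
begin

text \<open>Sharper than the Frobenius congruence: the error is divisible by \<open>2 * z\<close>.
  With \<open>z = \<pi>\<close> in \<open>M\<close> it then does not disturb the unit
  \<open>c\<close> in the Eisenstein equation. Working in a subring puts \<open>b\<close> in the
  ring generated by \<open>\<pi>\<close>, hence in \<open>C\<close>.\<close>

lemma one_plus_power_2:
  assumes z: "z \<in> R"
  shows "\<exists>b\<in>R. (1 + z) ^ (2 ^ k) = 1 + z ^ (2 ^ k) + 2 * z * b"
proof (induction k)
  case 0
  then show ?case by (auto intro!: bexI[of _ 0] closed)
next
  case (Suc k)
  then obtain b where b: "b \<in> R" "(1 + z) ^ (2 ^ k) = 1 + z ^ (2 ^ k) + 2 * z * b" by blast
  define x where "x = z ^ (2 ^ k - 1)"
  have x: "x \<in> R" "z ^ (2 ^ k) = z * x" using z unfolding x_def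
    by (auto intro: closed simp flip: power_Suc)
  have "(1 + z) ^ (2 ^ Suc k) = (1 + z * x + 2 * z * b)\<^sup>2"
    using b(2) x(2) by (simp add: power_mult mult.commute[of 2])
  also have "\<dots> = 1 + (z * x)\<^sup>2 + 2 * z * (2 * z * b\<^sup>2 + x + 2 * b + 2 * z * x * b)"
    by (simp add: algebra_simps power2_eq_square)
  also have "(z * x)\<^sup>2 = z ^ (2 ^ Suc k)" using x(2) by (simp add: power_mult mult.commute[of 2])
  finally show ?case using z x(1) b(1)
    by (intro bexI[of _ "2 * z * b\<^sup>2 + x + 2 * b + 2 * z * x * b"] closed)
qed

lemma one_plus_power_3:
  assumes z: "z \<in> R"
  shows "\<exists>b\<in>R. (1 + z) ^ (3 ^ k) = 1 + z ^ (3 ^ k) + 3 * z * b"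
proof (induction k)
  case 0
  then show ?case by (auto intro!: bexI[of _ 0] closed)
next
  case (Suc k)
  then obtain b where b: "b \<in> R" "(1 + z) ^ (3 ^ k) = 1 + z ^ (3 ^ k) + 3 * z * b" by blast
  define x where "x = z ^ (3 ^ k - 1)"
  have x: "x \<in> R" "z ^ (3 ^ k) = z * x" using z unfolding x_def
    by (auto intro: closed simp flip: power_Suc)
  \<comment> \<open>The expanded cube with \<open>3 * z\<close> taken out of all terms except 1 and
    \<open>(z * x) ^ 3\<close>.\<close>
  let ?b = "x + z * x * x + 9 * z\<^sup>2 * b ^ 3 + 3 * b + 9 * z * b\<^sup>2 + 3 * z\<^sup>2 * x\<^sup>2 * b
    + 9 * z\<^sup>2 * x * b\<^sup>2 + 6 * z * x * b"
  have "(1 + z) ^ (3 ^ Suc k) = (1 + z * x + 3 * z * b) ^ 3"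
    using b(2) x(2) by (simp add: power_mult mult.commute[of 3])
  also have "\<dots> = 1 + (z * x) ^ 3 + 3 * z * ?b"
    by (simp add: algebra_simps power2_eq_square power3_eq_cube)
  also have "(z * x) ^ 3 = z ^ (3 ^ Suc k)" using x(2) by (simp add: power_mult mult.commute[of 3])
  finally show ?case using z x(1) b(1) by (intro bexI[of _ ?b] closed)
qed

end

context place
begin

definition residues_in :: "complex set \<Rightarrow> complex \<Rightarrow> bool" where
  "residues_in A x \<longleftrightarrow> (\<forall>g. ratpoly g x \<in> V \<longrightarrow> (\<exists>a\<in>A. ratpoly g x - a \<in> M))"

lemma root_closed:
  assumes "x ^ n \<in> V" "n > 0" shows "x \<in> V"
proof (rule ccontr)
  assume x: "x \<notin> V"
  then have "x \<noteq> 0" "inverse x \<in> M" using valuation[of x] zero_closed by (auto simp: M_def)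
  moreover have "inverse x ^ n = inverse x * inverse x ^ (n - 1)"
    using assms(2) by (cases n) auto
  ultimately have "inverse x ^ n \<in> M" using M_mult' M_V closed by metis
  from M_mult[OF assms(1) this] have "1 \<in> M" using \<open>x \<noteq> 0\<close> by (simp add: power_inverse)
  then show False using one_not_M by simp
qed

lemma \<omega>_V: "\<omega> \<in> V"
  by (rule root_closed[of _ 3]) (auto simp: \<omega>_cube closed)

lemma M_mult_unit:
  assumes "x \<in> V" "y \<in> V" "x \<notin> M" "x * y \<in> M" shows "y \<in> M"
  using assms M_prime by blast

lemma M_cong: "x - y \<in> M \<Longrightarrow> x \<in> M \<longleftrightarrow> y \<in> M"
  using M_add[of "x - y" y] M_diff[of x "x - y"] by auto

lemma power_cong_1: "x - 1 \<in> M \<Longrightarrow> x ^ n - 1 \<in> M"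
proof (induction n)
  case (Suc n)
  have "x \<in> V" using M_V[OF Suc.prems] add_closed[of "x - 1" 1] closed by simp
  have "x ^ Suc n - 1 = x * (x ^ n - 1) + (x - 1)" by (simp add: algebra_simps)
  also have "\<dots> \<in> M" using Suc \<open>x \<in> V\<close> by (intro M_add M_mult) auto
  finally show ?case .
qed (simp add: zero_M)

lemma eisenstein_ints_V: "eisenstein_ints \<subseteq> V"
  unfolding eisenstein_ints_def using \<omega>_V by (auto intro!: closed)

end

lemma (in totally_ramified) residues_inI: "w \<in> C \<Longrightarrow> x \<in> C \<Longrightarrow> residues_in A x"
  unfolding residues_in_def using residue_poly by blast

section \<open>Local theory at 2\<close>

locale place_2 = place V 2 for V
begin

lemma two_M: "2 \<in> M" using p_M by simp

lemma odd_not_M: "odd k \<Longrightarrow> of_int k \<notin> M"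
  using M_of_int_iff[of k] by simp

lemma totally_ramified_eisenstein:
  assumes "\<pi> \<in> M" "e > 0" "w \<in> V" "w \<notin> M" "\<pi> ^ e = 2 * w"
  shows "totally_ramified V 2 eisenstein_ints F4_reps \<pi> w e"
proof -
  interpret E: unital_subring eisenstein_ints by (rule eisenstein_ints_subring)
  have "F4_reps \<subseteq> eisenstein_ints"
    unfolding F4_reps_def using \<omega>_eisenstein E.closed by auto
  moreover have "\<exists>a\<in>F4_reps. \<exists>b'\<in>eisenstein_ints. b = a + 2 * b'" if "b \<in> eisenstein_ints" for b
  proof -
    obtain k l where b: "b = of_int k + of_int l * \<omega>" using \<open>b \<in> _\<close> by (auto simp: eisenstein_ints_def)
    let ?a = "of_int (k mod 2) + of_int (l mod 2) * \<omega>"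
    have "k mod 2 \<in> {0, 1}" "l mod 2 \<in> {0, 1}" by auto
    then have "?a \<in> F4_reps" by (auto simp: F4_reps_def)
    moreover have "of_int (k div 2) + of_int (l div 2) * \<omega> \<in> eisenstein_ints"
      by (auto simp: eisenstein_ints_def)
    moreover have "b = ?a + 2 * (of_int (k div 2) + of_int (l div 2) * \<omega>)"
    proof -
      have "b = of_int (2 * (k div 2) + k mod 2) + of_int (2 * (l div 2) + l mod 2) * \<omega>"
        unfolding b by simp
      then show ?thesis unfolding of_int_add of_int_mult by (simp only: algebra_simps of_int_numeral)
    qed
    ultimately show ?thesis by blast
  qed
  moreover have "a = 0 \<or> (\<exists>u\<in>eisenstein_ints. \<exists>b\<in>eisenstein_ints. u * a = 1 + 2 * b)" if "a \<in> F4_reps" for a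
  proof -
    have "(- 1 - \<omega>) * \<omega> = - \<omega> - \<omega>\<^sup>2" "(- \<omega>) * (1 + \<omega>) = - \<omega> - \<omega>\<^sup>2"
      by (simp_all add: algebra_simps power2_eq_square)
    then have "1 * 1 = 1 + 2 * (0::complex)" "(- 1 - \<omega>) * \<omega> = 1 + 2 * 0" "(- \<omega>) * (1 + \<omega>) = 1 + 2 * 0"
      unfolding \<omega>_square by auto
    moreover have "- 1 - \<omega> \<in> eisenstein_ints" "- \<omega> \<in> eisenstein_ints"
      using \<omega>_eisenstein by (auto intro: E.closed)
    ultimately show ?thesis using that E.zero_closed E.one_closed unfolding F4_reps_def by blast
  qed
  ultimately show ?thesis
    using assms eisenstein_ints_subring eisenstein_ints_V place_axioms
    by (intro totally_ramified.intro totally_ramified_axioms.intro) auto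
qed

end

locale totally_ramified_2 = totally_ramified V 2 eisenstein_ints F4_reps \<pi> w e
  for V \<pi> w e
begin

sublocale place_2 V ..

lemma \<omega>_C: "\<omega> \<in> C" by (intro B_C \<omega>_eisenstein)

lemma two_J: "2 \<in> J 1" using p_J by simp

lemma J_unit_mult:
  assumes "x \<in> V" "y \<in> V" "y \<notin> M" "x * y \<in> J 1" shows "x \<in> J 1"
proof -
  have "x = (x * y) * inverse y" using not_M_nz[OF assms(3)] by simp
  then show ?thesis using J_mult_V[OF assms(4) inverse_closed[OF assms(2,3)]] by metis
qed

text \<open>An Artin-Schreier equation whose constant has residue 0 or 1 splits in F_4; this is why
  the coefficients are Eisenstein integers. Iterating \<open>z\<close> to
  \<open>d - z\<^sup>2\<close> multiplies the error by \<open>- (c + z)\<close>, which is a multiple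
  of 2 up to the error itself.\<close>

lemma artin_schreier_root:
  assumes c: "c \<in> V" "c\<^sup>2 + c = d" and d: "d \<in> C" "d \<in> J 1 \<or> d - 1 \<in> J 1"
  shows "c \<in> C"
proof -
  have "\<exists>a\<in>eisenstein_ints. d - a\<^sup>2 - a \<in> J 1"
  proof (cases "d \<in> J 1")
    case True
    then show ?thesis using unital_subring.zero_closed[OF B(1)] by (auto intro!: bexI[of _ 0])
  next
    case False
    then have "d - 1 + 2 \<in> J 1" using d J_add two_J by blast
    moreover have "d - \<omega>\<^sup>2 - \<omega> = d - 1 + 2" unfolding \<omega>_square by simp
    ultimately show ?thesis using \<omega>_eisenstein by metis
  qed
  then obtain a where a: "a \<in> eisenstein_ints" "d - a\<^sup>2 - a \<in> J 1" by blast
  have aC: "a \<in> C" "a \<in> V" using a B_C B_V by auto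
  have f: "(c - a) * (c + a + 1) \<in> J 1"
    using a(2) c(2) by (simp add: algebra_simps power2_eq_square)
  \<comment> \<open>The two factors differ by \<open>2 * a + 1\<close>, so one of them is a unit;
    cancelling it moves the other into \<open>J 1\<close>. The second case leads to the other root
    \<open>- a - 1\<close> of the reduced equation.\<close>
  have "\<exists>a\<in>C. c - a \<in> J 1"
  proof (cases "c - a \<in> M")
    case True
    have "(c + a + 1) - 1 = (c - a) + 2 * a" by simp
    also have "\<dots> \<in> M" using True aC two_M by (intro M_add M_mult') auto
    finally have "c + a + 1 \<notin> M" using M_cong one_not_M by blast
    have "c - a \<in> J 1"
      by (rule J_unit_mult[OF _ _ _ f]) (use c aC \<open>c + a + 1 \<notin> M\<close> in \<open>auto intro: closed\<close>)
    then show ?thesis using aC by blast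
  next
    case False
    have "c + a + 1 \<in> J 1"
      by (rule J_unit_mult[of _ "c - a"]) (use f c aC False in \<open>auto intro: closed simp: mult.commute\<close>)
    then show ?thesis using aC by (intro bexI[of _ "- a - 1"]) (auto intro: C.closed simp: algebra_simps)
  qed
  then obtain a where a: "a \<in> C" "c - a \<in> J 1" by blast
  show ?thesis
  proof (rule contraction_fixpoint[where T = "\<lambda>z. d - z\<^sup>2", OF c(1) a])
    fix z N assume z: "z \<in> C" "N \<ge> (1::nat)" "c - z \<in> J N"
    have "c - (d - z\<^sup>2) = (c - z) * (- (c + z))"
      using c(2) by (simp add: algebra_simps power2_eq_square)
    moreover have "- (c + z) = (c - z) - 2 * c" by simp
    then have "- (c + z) \<in> J 1"
      using J_diff[OF J_mono[OF z(3) z(2)] J_mult_V[OF two_J c(1)]] by metis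
    ultimately show "c - (d - z\<^sup>2) \<in> J (Suc N)" using J_Suc_mult z by metis
  qed (use d in \<open>auto intro: C.closed\<close>)
qed

text \<open>An arbitrary cube root becomes congruent to 1 after rotation by a power of
  \<open>\<omega>\<close>. The iteration needs no division by the derivative, since 3 is 1 modulo
  2.\<close>

lemma cube_root:
  assumes wC: "w \<in> C" and y: "y \<in> C" "y - 1 \<in> M"
  obtains x where "x \<in> C" "x ^ 3 = y" "x - 1 \<in> M"
proof -
  obtain x0 where x0: "x0 ^ 3 = y" using nth_root_exists[of 3 y] by auto
  have x0V: "x0 \<in> V" by (rule root_closed[of _ 3]) (use x0 y C_V in auto)
  have "(x0 - \<omega>) * (x0 - \<omega>\<^sup>2) = x0\<^sup>2 - (\<omega> + \<omega>\<^sup>2) * x0 + \<omega> ^ 3"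
    by (simp add: algebra_simps power2_eq_square power3_eq_cube)
  also have "\<dots> = x0\<^sup>2 + x0 + 1" unfolding \<omega>_cube \<omega>_square by simp
  finally have "(x0 - 1) * ((x0 - \<omega>) * (x0 - \<omega>\<^sup>2)) = y - 1"
    unfolding x0[symmetric] by (simp add: algebra_simps power2_eq_square power3_eq_cube)
  then have "(x0 - 1) * ((x0 - \<omega>) * (x0 - \<omega>\<^sup>2)) \<in> M" using y(2) by simp
  moreover have "x0 - 1 \<in> V" "x0 - \<omega> \<in> V" "x0 - \<omega>\<^sup>2 \<in> V"
    using x0V \<omega>_V by (auto intro: closed)
  ultimately have "x0 - 1 \<in> M \<or> x0 - \<omega> \<in> M \<or> x0 - \<omega>\<^sup>2 \<in> M"
    using M_prime mult_closed by blast
  then obtain i where i: "\<omega> ^ i * x0 - 1 \<in> M"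
  proof (elim disjE)
    assume a: "x0 - \<omega> \<in> M"
    have "\<omega> ^ 2 * x0 - 1 = \<omega> ^ 2 * (x0 - \<omega>)"
      using \<omega>_cube by (simp add: algebra_simps power2_eq_square power3_eq_cube)
    then show ?thesis using that[of 2] M_mult[OF _ a, of "\<omega> ^ 2"] \<omega>_V closed by auto
  next
    assume a: "x0 - \<omega>\<^sup>2 \<in> M"
    have "\<omega> ^ 1 * x0 - 1 = \<omega> * (x0 - \<omega>\<^sup>2)"
      using \<omega>_cube by (simp add: algebra_simps power2_eq_square power3_eq_cube)
    then show ?thesis using that[of 1] M_mult[OF _ a, of \<omega>] \<omega>_V by auto
  qed (use that[of 0] in auto)
  define x where "x = \<omega> ^ i * x0"
  have x: "x ^ 3 = y" "x - 1 \<in> M" "x \<in> V"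
    using i x0 \<omega>_power_mult_3[of 3 i] x0V \<omega>_V by (auto simp: x_def power_mult_distrib intro!: closed)
  \<comment> \<open>The cofactor of \<open>x - 1\<close> in \<open>y - 1\<close> is congruent to 3,
    a unit, so \<open>x - 1\<close> inherits membership in \<open>J 1\<close> from
    \<open>y - 1\<close>.\<close>
  have "of_int 3 \<notin> M" by (rule odd_not_M) simp
  moreover have "(x\<^sup>2 + x + 1) - of_int 3 = (x - 1) * (x + 2)"
    by (simp add: algebra_simps power2_eq_square)
  ultimately have "x\<^sup>2 + x + 1 \<notin> M" using M_cong M_mult'[OF x(2), of "x + 2"] x closed by metis
  moreover have "(x - 1) * (x\<^sup>2 + x + 1) = y - 1"
    unfolding x(1)[symmetric] by (simp add: algebra_simps power2_eq_square power3_eq_cube)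
  moreover have "y - 1 \<in> J 1" using C_M_J[OF wC] y C.closed by blast
  ultimately have x1: "x - 1 \<in> J 1" 
    by (intro J_unit_mult[of "x - 1" "x\<^sup>2 + x + 1"]) (use x in \<open>auto intro: closed\<close>)
  have "x \<in> C"
  proof (rule contraction_fixpoint[where T = "\<lambda>z. z + (y - z ^ 3)", OF x(3) C.one_closed x1])
    fix z N assume z: "z \<in> C" "N \<ge> (1::nat)" "x - z \<in> J N"
    have "x - (z + (y - z ^ 3)) = (x - z) * (1 - x\<^sup>2 - x * z - z\<^sup>2)"
      unfolding x(1)[symmetric] by (simp add: algebra_simps power2_eq_square power3_eq_cube)
    moreover have "1 - x\<^sup>2 - x * z - z\<^sup>2 = (x - z) * (2 * x + z) - 3 * (x - 1) * (x + 1) - 2"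
      by (simp add: algebra_simps power2_eq_square)
    moreover have "(x - z) * (2 * x + z) - 3 * (x - 1) * (x + 1) - 2 \<in> J 1"
      using z x C_V two_J
      by (intro J_diff J_mult_V J_V_mult J_mono[OF z(3) z(2)] x1) (auto intro!: closed)
    ultimately show "x - (z + (y - z ^ 3)) \<in> J (Suc N)" using J_Suc_mult z by metis
  qed (use y in \<open>auto intro: C.closed\<close>)
  with x that show ?thesis by blast
qed

lemma cube_root_power:
  assumes wC: "w \<in> C" and y: "y \<in> C" "y - 1 \<in> M"
  shows "\<exists>x\<in>C. x ^ (3 ^ k) = y \<and> x - 1 \<in> M"
proof (induction k)
  case 0
  then show ?case using y by auto
next
  case (Suc k)
  then obtain x where x: "x \<in> C" "x ^ (3 ^ k) = y" "x - 1 \<in> M" by blast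
  obtain x' where "x' \<in> C" "x' ^ 3 = x" "x' - 1 \<in> M" by (rule cube_root[OF wC x(1,3)])
  then show ?case using x(2) by (intro bexI[of _ x']) (auto simp: power_mult)
qed

end

section \<open>Roots with residues in F_4\<close>

context place_2
begin

text \<open>With \<open>\<pi> = \<eta> - 1\<close> the equation for \<open>\<eta>\<close> becomes an Eisenstein equation, since \<open>c\<close> is a unit. The
  equation for \<open>f\<close> only serves to place \<open>f\<close>, and hence \<open>c\<close>, in the closure.\<close>

lemma residues_F4_conjugates:
  fixes d k :: int
  assumes c: "c \<notin> M" "c\<^sup>2 + c = f" and f: "f \<in> V" "f + 2 * of_int k * f\<^sup>2 = of_int d"
    and \<eta>: "\<eta> ^ (2 ^ t) = 1 + 2 * c"
  shows "\<exists>x. x ^ (3 ^ v) = \<eta> ^ l \<and> x - 1 \<in> M \<and> (\<forall>i. residues_in F4_reps (\<omega> ^ i * x))"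
proof -
  have cV: "c \<in> V" using quadratic_root_closed[of 1 "- f" c] c(2) f(1) closed by simp
  define \<pi> where "\<pi> = \<eta> - 1"
  have "\<eta> ^ (2 ^ t) \<in> V" unfolding \<eta> using cV by (intro closed)
  then have "\<eta> \<in> V" by (rule root_closed) simp
  then have \<pi>V: "\<pi> \<in> V" unfolding \<pi>_def by (intro closed)
  let ?G = "{poly f \<pi> | f. \<forall>i. coeff f i \<in> eisenstein_ints}"
  interpret G: unital_subring ?G
    by (rule unital_subring.adjoin_subring[OF eisenstein_ints_subring])
  have "\<pi> \<in> ?G"
    using unital_subring.zero_closed[OF eisenstein_ints_subring] unital_subring.one_closed[OF eisenstein_ints_subring]
    by (intro CollectI exI[of _ "[:0,1:]"]) (auto simp: coeff_pCons split: nat.splits)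
  then obtain b where b: "b \<in> ?G" "(1 + \<pi>) ^ (2 ^ t) = 1 + \<pi> ^ (2 ^ t) + 2 * \<pi> * b"
    using G.one_plus_power_2 by blast
  have bV: "b \<in> V" using b(1) eisenstein_ints_V \<pi>V by (auto intro!: poly_closed)
  define w where "w = c - \<pi> * b"
  have \<pi>w: "\<pi> ^ (2 ^ t) = 2 * w"
    using b(2) \<eta> unfolding w_def \<pi>_def by (simp add: algebra_simps)
  have wV: "w \<in> V" unfolding w_def using cV \<pi>V bV by (intro closed)
  have "\<pi> ^ (2 ^ t) \<in> M" unfolding \<pi>w using wV by (intro M_mult' two_M)
  then have \<pi>M: "\<pi> \<in> M" using M_power \<pi>V by blast
  have wM: "w \<notin> M"
  proof -
    have "w - c \<in> M" unfolding w_def using M_uminus[OF M_mult'[OF \<pi>M bV]] by simp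
    then show ?thesis using M_cong c by blast
  qed
  interpret T: totally_ramified_2 V \<pi> w "2 ^ t"
    unfolding totally_ramified_2_def
    using \<pi>M wV wM \<pi>w by (intro totally_ramified_eisenstein) auto
  have bC: "b \<in> T.C" using b(1) by (intro T.G_C) (simp add: T.G_def)
  have f2: "2 * of_int k * z \<in> T.J 1" if "z \<in> V" for z
    using that unfolding mult.assoc by (intro T.J_mult_V[OF T.two_J] closed)
  have "f \<in> T.C"
  proof (rule T.contraction_fixpoint[where T = "\<lambda>z. of_int d - 2 * of_int k * z\<^sup>2" and a = "of_int d"])
    have "f - of_int d = 2 * of_int k * (- f\<^sup>2)" using f(2) by (simp add: algebra_simps)
    then show "f - of_int d \<in> T.J 1" using f2[of "- f\<^sup>2"] f(1) closed by simp
  next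
    fix z N assume z: "z \<in> T.C" "f - z \<in> T.J N"
    have "f - (of_int d - 2 * of_int k * z\<^sup>2) = (f - z) * (2 * of_int k * (- (f + z)))"
      unfolding f(2)[symmetric] by (simp add: algebra_simps power2_eq_square)
    moreover have "2 * of_int k * (- (f + z)) \<in> T.J 1" using f(1) z T.C_V by (intro f2 closed) auto
    ultimately show "f - (of_int d - 2 * of_int k * z\<^sup>2) \<in> T.J (Suc N)"
      using T.J_Suc_mult z by metis
  qed (use f(1) in \<open>auto intro!: T.C.closed\<close>)
  \<comment> \<open>The residue of \<open>f\<close> is that of the integer \<open>d\<close>, hence 0
    or 1, as \<open>artin_schreier_root\<close> requires.\<close>
  moreover have "f \<in> T.J 1 \<or> f - 1 \<in> T.J 1"
  proof -
    have e: "f = of_int (d mod 2) + 2 * (of_int (d div 2) - of_int k * f\<^sup>2)"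
    proof -
      have "of_int d = (of_int (2 * (d div 2) + d mod 2) :: complex)" by simp
      then have "f = of_int (2 * (d div 2) + d mod 2) - 2 * of_int k * f\<^sup>2"
        using f(2) by (metis add_diff_cancel_right')
      also have "(of_int (2 * (d div 2) + d mod 2) :: complex) = 2 * of_int (d div 2) + of_int (d mod 2)"
        by (simp only: of_int_add of_int_mult of_int_numeral)
      finally show ?thesis by (simp add: algebra_simps)
    qed
    have "2 * (of_int (d div 2) - of_int k * f\<^sup>2) \<in> T.J 1"
      using f(1) by (intro T.J_mult_V[OF T.two_J] closed)
    moreover have "d mod 2 = 0 \<or> d mod 2 = 1" by auto
    ultimately show ?thesis using e by (metis add_diff_cancel_left' add_0 of_int_0 of_int_1)
  qed
  ultimately have "c \<in> T.C" using T.artin_schreier_root cV c(2) by blast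
  then have wC: "w \<in> T.C" unfolding w_def using T.\<pi>_C bC by (intro T.C.closed)
  have "\<eta> \<in> T.C" using T.C.add_closed[OF T.\<pi>_C T.C.one_closed] by (simp add: \<pi>_def)
  then have "\<eta> ^ l \<in> T.C" by (intro T.C.closed)
  moreover have "\<eta> ^ l - 1 \<in> M" using \<pi>M power_cong_1 unfolding \<pi>_def by blast
  ultimately obtain x where x: "x \<in> T.C" "x ^ (3 ^ v) = \<eta> ^ l" "x - 1 \<in> M"
    using T.cube_root_power[OF wC] by blast
  have "residues_in F4_reps (\<omega> ^ i * x)" for i
    by (rule T.residues_inI[OF wC T.C.mult_closed[OF T.C.power_closed[OF T.\<omega>_C] x(1)]])
  with x show ?thesis by blast
qed

text \<open>If \<open>c = (s - 1) / 2\<close> is not a unit then \<open>s\<close> has square roots \<open>1 + 2 * c'\<close>, and \<open>c'\<close> is a unit for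
  one of them. When \<open>u = 1\<close> such a square root need not be a power of \<open>x\<close>, but the larger ring that it
  generates still contains \<open>s\<close>.\<close>

lemma square_root_extension:
  fixes m :: int
  assumes m: "[m = 1] (mod 4)" and s: "s\<^sup>2 = of_int m" and u: "u > 0"
  shows "\<exists>x. x ^ (2 ^ (u - 1) * 3 ^ v) = s \<and> x - 1 \<in> M \<and> (\<forall>i. residues_in F4_reps (\<omega> ^ i * x))"
proof -
  obtain d where d: "m = 1 + 4 * d" using m by (metis cong_iff_lin mult.commute cong_sym)
  define c where "c = (s - 1) / 2"
  have sc: "s = 1 + 2 * c" by (simp add: c_def)
  have cd: "c\<^sup>2 + c = of_int d"
  proof -
    have "c\<^sup>2 + c = (s\<^sup>2 - 1) / 4" unfolding sc by (simp add: field_simps power2_eq_square)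
    then show ?thesis using s d by simp
  qed
  have cV: "c \<in> V" using quadratic_root_closed[of 1 "- of_int d" c] cd closed by simp
  show ?thesis
  proof (cases "c \<in> M")
    case False
    obtain \<eta> where \<eta>: "\<eta> ^ (2 ^ (u - 1)) = 1 + 2 * c" using nth_root_exists[of "2 ^ (u - 1)" "1 + 2 * c"] by auto
    obtain x where x: "x ^ (3 ^ v) = \<eta> ^ 1" "x - 1 \<in> M" "\<forall>i. residues_in F4_reps (\<omega> ^ i * x)"
      using residues_F4_conjugates[OF False cd closed(9) _ \<eta>, of 0 d v 1] by auto
    then show ?thesis using \<eta> sc by (intro exI[of _ x]) (simp add: mult.commute[of "2 ^ _"] power_mult)
  next
    case True
    have "of_int d \<in> M" unfolding cd[symmetric] using M_mult[OF cV True]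
      by (intro M_add True) (simp add: power2_eq_square)
    then obtain d' where d': "d = 2 * d'" using M_of_int_iff by auto
    have "(c + 1) - 1 \<in> M" using True by simp
    then have c1: "c + 1 \<notin> M" using M_cong one_not_M by blast
    \<comment> \<open>This is \<open>c / 2\<close>, in a form that exhibits it as an element of
      \<open>V\<close>; its equation below is \<open>c\<^sup>2 + c = d\<close> divided by 2.\<close>
    define f where "f = of_int d' * inverse (c + 1)"
    have fV: "f \<in> V" unfolding f_def using c1 cV by (intro closed inverse_closed) 
    have cf: "c = 2 * f"
    proof -
      have "c * (c + 1) = 2 * of_int d'" using cd d' by (simp add: algebra_simps power2_eq_square)
      then show ?thesis unfolding f_def using not_M_nz[OF c1] by (simp add: field_simps)
    qed
    have fd: "f + 2 * of_int 1 * f\<^sup>2 = of_int d'"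
    proof -
      have "f + 2 * of_int 1 * f\<^sup>2 = (c\<^sup>2 + c) / 2"
        unfolding cf by (simp add: field_simps power2_eq_square)
      then show ?thesis using cd d' by simp
    qed
    \<comment> \<open>The two square roots of \<open>s\<close> belong to \<open>c0\<close> and
      \<open>- 1 - c0\<close>, which sum to -1 and so are not both in \<open>M\<close>.\<close>
    have "\<exists>c'. c' \<notin> M \<and> c'\<^sup>2 + c' = f \<and> (1 + 2 * c')\<^sup>2 = s"
    proof -
      define c0 where "c0 = (csqrt s - 1) / 2"
      have "(1 + 2 * c0)\<^sup>2 = s" by (simp add: c0_def)
      moreover have "c0\<^sup>2 + c0 = ((1 + 2 * c0)\<^sup>2 - 1) / 4" by (simp add: field_simps power2_eq_square)
      ultimately have c0: "c0\<^sup>2 + c0 = f" unfolding sc cf by simp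
      show ?thesis
      proof (cases "c0 \<in> M")
        case False
        then show ?thesis using c0 \<open>(1 + 2 * c0)\<^sup>2 = s\<close> by blast
      next
        case True
        have "- 1 - c0 \<notin> M"
          using M_uminus[OF M_add[OF True, of "- 1 - c0"]] one_not_M by auto
        moreover have "(- 1 - c0)\<^sup>2 + (- 1 - c0) = f" using c0 by (simp add: algebra_simps power2_eq_square)
        moreover have "(1 + 2 * (- 1 - c0))\<^sup>2 = s"
          using \<open>(1 + 2 * c0)\<^sup>2 = s\<close> by (simp add: algebra_simps power2_eq_square)
        ultimately show ?thesis by blast
      qed
    qed
    then obtain c' where c': "c' \<notin> M" "c'\<^sup>2 + c' = f" "(1 + 2 * c')\<^sup>2 = s" by blast
    \<comment> \<open>For \<open>u = 1\<close> the exponent \<open>u - 2\<close> truncates to 0 and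
      \<open>\<eta>\<close> is itself a square root of \<open>s\<close>; the power
      \<open>l = 2\<close> then leads back to \<open>s\<close>.\<close>
    obtain \<eta> where \<eta>: "\<eta> ^ (2 ^ (u - 2)) = 1 + 2 * c'" using nth_root_exists[of "2 ^ (u - 2)" "1 + 2 * c'"] by auto
    define l :: nat where "l = (if u = 1 then 2 else 1)"
    have l: "l * 2 ^ (u - 1) = 2 ^ (u - 2) * 2"
    proof (cases "u = 1")
      case False
      then have "u - 1 = Suc (u - 2)" using u by simp
      then show ?thesis using False by (simp add: l_def)
    qed (simp add: l_def)
    obtain x where x: "x ^ (3 ^ v) = \<eta> ^ l" "x - 1 \<in> M" "\<forall>i. residues_in F4_reps (\<omega> ^ i * x)"
      using residues_F4_conjugates[OF c'(1,2) fV fd \<eta>, of v l] by auto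
    have "x ^ (2 ^ (u - 1) * 3 ^ v) = (x ^ (3 ^ v)) ^ (2 ^ (u - 1))"
      by (simp add: mult.commute[of "2 ^ _"] power_mult)
    also have "\<dots> = (\<eta> ^ (2 ^ (u - 2))) ^ 2" unfolding x(1) power_mult[symmetric] l ..
    also have "\<dots> = s" using \<eta> c' by simp
    finally show ?thesis using x by blast
  qed
qed

lemma not_monogenic_mod_4:
  fixes m :: int
  assumes u: "u > 0" and v: "v > 0" and m: "[m = 1] (mod 4)"
    and F: "F = Polynomial.monom 1 (2 ^ u * 3 ^ v) - [:of_int m:]" "Factorial_Ring.irreducible F" "ratpoly F \<alpha> = 0"
  shows "\<not> monogenic (rat_adjoin \<alpha>)"
proof -
  obtain d where d: "m = 1 + 4 * d" using m by (metis cong_iff_lin mult.commute cong_sym)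
  let ?N = "2 ^ (u - 1) * 3 ^ v :: nat"
  have N: "2 ^ u * 3 ^ v = ?N * 2" using u by (cases u) auto
  have F_eval: "ratpoly F x = (x ^ ?N)\<^sup>2 - of_int m" for x
    unfolding F(1) N by (simp add: ratpoly_diff ratpoly_monom ratpoly_const power_mult)
  define s where "s = csqrt (of_int m)"
  have s: "s\<^sup>2 = of_int m" "(- s)\<^sup>2 = of_int m" by (simp_all add: s_def)
  obtain x0 where x0: "x0 ^ ?N = s" "x0 - 1 \<in> M" "\<forall>i. residues_in F4_reps (\<omega> ^ i * x0)"
    using square_root_extension[OF m s(1) u] by blast
  obtain x1 where x1: "x1 ^ ?N = - s" "x1 - 1 \<in> M" "\<forall>i. residues_in F4_reps (\<omega> ^ i * x1)"
    using square_root_extension[OF m s(2) u] by blast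
  define x where "x = (\<lambda>i::nat. if i = 0 then x0 else x1)"
  define r where "r = (\<lambda>(i, j). \<omega> ^ j * x i)"
  have xN: "x i ^ ?N = (if i = 0 then s else - s)" and x: "x i - 1 \<in> M" "residues_in F4_reps (\<omega> ^ j * x i)" for i j
    using x0 x1 by (auto simp: x_def)
  \<comment> \<open>As 3 divides \<open>?N\<close>, rotating by \<open>\<omega>\<close> keeps a root
    above the same square root of \<open>m\<close>.\<close>
  have rN: "r (i, j) ^ ?N = (if i = 0 then s else - s)" for i j
    unfolding r_def using v xN[of i] by (simp add: power_mult_distrib \<omega>_power_mult_3)
  let ?I = "{0, 1::nat} \<times> {0, 1, 2::nat}"
  have s_unit: "s \<notin> M"
  proof
    assume "s \<in> M"
    then have "s * s \<in> M" using M_mult M_V by blast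
    then have "of_int m \<in> M" using s by (simp add: power2_eq_square)
    then show False using odd_not_M[of m] d by simp
  qed
  show ?thesis
  proof (rule not_monogenic_if_many_residues[OF F(2,3), of ?I r F4_reps])
    show "ratpoly F (r i) = 0" for i
      using rN[of "fst i" "snd i"] s by (simp add: F_eval)
    have "card F4_reps \<le> 4" unfolding F4_reps_def using card_length[of "[0, 1, \<omega>, 1 + \<omega>]"] by simp
    then show "card F4_reps < card ?I" by (simp add: card_cartesian_product)
    show "finite F4_reps" by (simp add: F4_reps_def)
    show "\<exists>a\<in>F4_reps. ratpoly g (r i) - a \<in> M" if "ratpoly g (r i) \<in> V" for i g
      using x(2)[of "snd i" "fst i"] that unfolding residues_in_def r_def by (auto simp: case_prod_unfold)
  next
    fix i j assume ij: "i \<in> ?I" "j \<in> ?I" "i \<noteq> j"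
    obtain i1 i2 j1 j2 where e: "i = (i1, i2)" "j = (j1, j2)" by fastforce
    show "\<exists>h. algebraic_int (ratpoly h \<alpha>) \<and> ratpoly h (r i) - ratpoly h (r j) \<notin> M"
    proof (cases "i1 = j1")
      case True
      have "algebraic_int \<alpha>" using algebraic_int_root_monom[OF F(1) _ F(3)] by simp
      moreover have "r i - r j \<notin> M"
      proof
        assume "r i - r j \<in> M"
        then have *: "x i1 * (\<omega> ^ i2 - \<omega> ^ j2) \<in> M" using True by (simp add: r_def e algebra_simps)
        have "x i1 \<notin> M" using x(1)[of i1] M_cong one_not_M by blast
        moreover have "x i1 \<in> V" using M_V[OF x(1)[of i1]] add_closed[of "x i1 - 1" 1] closed by simp
        ultimately have "\<omega> ^ i2 - \<omega> ^ j2 \<in> M" 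
          using M_mult_unit[OF _ _ _ *] \<omega>_V by (auto intro: closed)
        from M_mult'[OF this, of "\<omega> ^ (2 * i2) - \<omega> ^ (2 * j2)"] have "3 \<in> M"
          using \<omega>_power_diff[of i2 j2] ij e True \<omega>_V closed by auto
        then show False using odd_not_M[of 3] by simp
      qed
      ultimately show ?thesis by (intro exI[of _ "[:0,1:]"]) (simp add: ratpoly_pCons)
    next
      case False
      let ?h = "smult (1/2) (Polynomial.monom 1 ?N + 1)"
      have h: "ratpoly ?h y = (y ^ ?N + 1) / 2" for y
        using ratpoly_const[of 1 y] by (simp add: ratpoly_smult ratpoly_add ratpoly_monom of_rat_divide one_pCons)
      have "algebraic_int ((\<alpha> ^ ?N + 1) / 2)"
      proof (rule algebraic_int.intros)
        show "poly [:- of_int d, - 1, 1:] ((\<alpha> ^ ?N + 1) / 2) = 0"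
          using F(3) d unfolding F_eval by (simp add: field_simps power2_eq_square)
      qed (auto simp: coeff_pCons split: nat.splits)
      moreover have "ratpoly ?h (r i) - ratpoly ?h (r j) = s \<or> ratpoly ?h (r i) - ratpoly ?h (r j) = - s"
        unfolding h e rN using False ij e by (auto simp: field_simps)
      ultimately show ?thesis unfolding h using s_unit M_uminus[of "- s"]
        by (metis h minus_minus)
    qed
  qed
qed

end

section \<open>The case 9 | m - 1\<close>

definition F3_reps :: "complex set" where "F3_reps = {0, 1, 2}"

lemma Ints_subring: "unital_subring (\<int> :: complex set)"
  by standard auto

section \<open>Local theory at 3\<close>

locale place_3 = place V 3 for V
begin

lemma Ints_V: "x \<in> \<int> \<Longrightarrow> x \<in> V"
  by (elim Ints_cases) (simp add: closed)

lemma three_M: "3 \<in> M" using p_M by simp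

lemma of_int_not_M: "\<not> 3 dvd k \<Longrightarrow> of_int k \<notin> M"
  using M_of_int_iff[of k] by simp

lemma totally_ramified_Ints:
  assumes "\<pi> \<in> M" "e > 0" "w \<in> V" "w \<notin> M" "\<pi> ^ e = 3 * w"
  shows "totally_ramified V 3 \<int> F3_reps \<pi> w e"
proof -
  have "F3_reps \<subseteq> \<int>" unfolding F3_reps_def by auto
  moreover have "\<exists>a\<in>F3_reps. \<exists>b'\<in>\<int>. b = a + 3 * b'" if "b \<in> \<int>" for b
  proof -
    obtain k where b: "b = of_int k" using \<open>b \<in> _\<close> by (elim Ints_cases)
    have "k mod 3 \<in> {0, 1, 2}" by auto
    then have "of_int (k mod 3) \<in> F3_reps" by (auto simp: F3_reps_def)
    moreover have "b = of_int (k mod 3 + 3 * (k div 3))" unfolding b by simp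
    then have "b = of_int (k mod 3) + 3 * of_int (k div 3)"
      by (simp only: of_int_add of_int_mult of_int_numeral)
    ultimately show ?thesis using Ints_of_int by blast
  qed
  moreover have "a = 0 \<or> (\<exists>u\<in>\<int>. \<exists>b\<in>\<int>. u * a = 1 + 3 * b)" if "a \<in> F3_reps" for a
  proof -
    have "1 * 1 = 1 + 3 * (0::complex)" "2 * 2 = 1 + 3 * (1::complex)" by auto
    moreover have "(0::complex) \<in> \<int>" "(1::complex) \<in> \<int>" "(2::complex) \<in> \<int>" by auto
    ultimately show ?thesis using that unfolding F3_reps_def by blast
  qed
  moreover have "\<int> \<subseteq> V" using Ints_V by blast
  ultimately show ?thesis
    using assms Ints_subring place_axioms
    by (intro totally_ramified.intro totally_ramified_axioms.intro) auto
qed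

end

locale totally_ramified_3 = totally_ramified V 3 \<int> F3_reps \<pi> w e
  for V \<pi> w e
begin

sublocale place_3 V ..

lemma three_J: "3 \<in> J 1" using p_J by simp

text \<open>The factor 3 is itself the contraction: passing from \<open>z\<close> to
  \<open>f + 3 * g z\<close> multiplies the error by 3 times a difference quotient of
  \<open>g\<close>.\<close>

lemma perturbation_fixpoint:
  assumes x: "x \<in> V" "x = f + 3 * g x" and f: "f \<in> C" and g: "\<And>z. z \<in> C \<Longrightarrow> g z \<in> C" "g x \<in> V"
    and lip: "\<And>z. z \<in> V \<Longrightarrow> \<exists>r\<in>V. g x - g z = (x - z) * r"
  shows "x \<in> C"
proof (rule contraction_fixpoint[where T = "\<lambda>z. f + 3 * g z", OF x(1) f])
  have "x - f = 3 * g x" using x(2) by (metis add_diff_cancel_left')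
  then show "x - f \<in> J 1" using J_mult_V[OF three_J g(2)] by simp
next
  fix z N assume z: "z \<in> C" "N \<ge> (1::nat)" "x - z \<in> J N"
  obtain r where r: "r \<in> V" "g x - g z = (x - z) * r" using lip C_V z by blast
  have "x - (f + 3 * g z) = 3 * (g x - g z)" by (subst x(2)) (simp add: algebra_simps)
  also have "\<dots> = (x - z) * (3 * r)" unfolding r by simp
  finally show "x - (f + 3 * g z) \<in> J (Suc N)"
    using J_Suc_mult[OF z(3) J_mult_V[OF three_J r(1)]] by simp
qed (use f g in \<open>auto intro: C.closed\<close>)

text \<open>Covers both cubics in use: \<open>c + 3 * c\<^sup>2 + 3 * c ^ 3 = d\<close>, which is
  \<open>(1 + 3 * c) ^ 3 = 1 + 9 * d\<close>, and what it becomes on substituting a multiple of 3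
  for \<open>c\<close> and dividing by 3.\<close>

lemma perturbed_cubic_fixpoint:
  assumes x: "x \<in> V" "x + 3 * (a * x\<^sup>2 + b * x ^ 3) = f" and "f \<in> C" "a \<in> C" "b \<in> C"
  shows "x \<in> C"
proof (rule perturbation_fixpoint[of x f "\<lambda>z. - (a * z\<^sup>2 + b * z ^ 3)", OF x(1)])
  show "x = f + 3 * - (a * x\<^sup>2 + b * x ^ 3)" using x(2) by (simp add: algebra_simps)
  show "- (a * x\<^sup>2 + b * x ^ 3) \<in> V" using assms C_V by (intro closed) auto
  show "- (a * z\<^sup>2 + b * z ^ 3) \<in> C" if "z \<in> C" for z using assms that by (intro C.closed)
  show "\<exists>r\<in>V. - (a * x\<^sup>2 + b * x ^ 3) - - (a * z\<^sup>2 + b * z ^ 3) = (x - z) * r" if "z \<in> V" for z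
    using assms that C_V
    by (intro bexI[of _ "- (a * (x + z) + b * (x\<^sup>2 + x * z + z\<^sup>2))"] closed)
      (auto simp: algebra_simps power2_eq_square power3_eq_cube)
qed (use assms in auto)

lemma square_root:
  assumes wC: "w \<in> C" and y: "y \<in> C" "y - 1 \<in> M"
  obtains x where "x \<in> C" "x\<^sup>2 = y" "x - 1 \<in> M"
proof -
  let ?r = "csqrt y"
  have r2: "?r\<^sup>2 \<in> V" using y C_V by simp
  have rV: "?r \<in> V" by (rule root_closed[OF r2]) simp
  have "(?r - 1) * (?r + 1) = ?r\<^sup>2 - 1" by (simp add: algebra_simps power2_eq_square)
  also have "\<dots> \<in> M" using y by simp
  finally have "?r - 1 \<in> M \<or> ?r + 1 \<in> M" 
    using M_prime[OF diff_closed[OF rV one_closed] add_closed[OF rV one_closed]] by blast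
  then have "\<exists>x. x\<^sup>2 = y \<and> x - 1 \<in> M \<and> x \<in> V"
  proof
    assume "?r + 1 \<in> M"
    then have "- ?r - 1 \<in> M" using M_uminus by fastforce
    then show ?thesis using rV closed by (intro exI[of _ "- ?r"]) simp
  qed (use rV in \<open>auto intro!: exI[of _ ?r]\<close>)
  then obtain x where x: "x\<^sup>2 = y" "x - 1 \<in> M" "x \<in> V" by blast
  have "of_int 2 \<notin> M" by (rule of_int_not_M) simp
  moreover have "(x + 1) - of_int 2 \<in> M" using x by simp
  ultimately have x1: "x + 1 \<notin> M" using M_cong by blast
  have "(x - 1) * (x + 1) = y - 1"
    unfolding x(1)[symmetric] by (simp add: algebra_simps power2_eq_square)
  then have "x - 1 = (y - 1) * inverse (x + 1)" using not_M_nz[OF x1] by (simp add: field_simps)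
  moreover have "y - 1 \<in> J 1" using C_M_J[OF wC] y C.closed by blast
  ultimately have xJ: "x - 1 \<in> J 1"
    using J_mult_V[OF _ inverse_closed[OF _ x1]] x(3) closed by simp
  have "x \<in> C"
  \<comment> \<open>The derivative 2 is -1 modulo 3, whence the sign of the correction: the error is
    multiplied by \<open>1 + x + z\<close>, which is 3 up to elements of \<open>J 1\<close>.\<close>
  proof (rule contraction_fixpoint[where T = "\<lambda>z. z - (y - z\<^sup>2)", OF x(3) C.one_closed xJ])
    fix z N assume z: "z \<in> C" "N \<ge> (1::nat)" "x - z \<in> J N"
    have "x - (z - (y - z\<^sup>2)) = (x - z) * (3 + (x - 1) * 2 - (x - z))"
      unfolding x(1)[symmetric] by (simp add: algebra_simps power2_eq_square)
    moreover have "3 + (x - 1) * 2 - (x - z) \<in> J 1"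
      by (intro J_diff J_add three_J J_mult_V[OF xJ] J_mono[OF z(3,2)] closed)
    ultimately show "x - (z - (y - z\<^sup>2)) \<in> J (Suc N)" using J_Suc_mult z by metis
  qed (use y in \<open>auto intro: C.closed\<close>)
  with x that show ?thesis by blast
qed

lemma square_root_power:
  assumes wC: "w \<in> C" and y: "y \<in> C" "y - 1 \<in> M"
  shows "\<exists>x\<in>C. x ^ (2 ^ k) = y \<and> x - 1 \<in> M"
proof (induction k)
  case 0
  then show ?case using y by auto
next
  case (Suc k)
  then obtain x where x: "x \<in> C" "x ^ (2 ^ k) = y" "x - 1 \<in> M" by blast
  obtain x' where "x' \<in> C" "x'\<^sup>2 = x" "x' - 1 \<in> M" by (rule square_root[OF wC x(1,3)])
  then show ?case using x(2) by (intro bexI[of _ x']) (auto simp: power_mult)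
qed

lemma residues_F3_opposites:
  assumes wC: "w \<in> C" and \<eta>: "\<eta> = 1 + \<pi>"
  shows "\<exists>x. x ^ (2 ^ u) = \<eta> ^ l \<and> x - 1 \<in> M \<and> residues_in F3_reps x \<and> residues_in F3_reps (- x)"
proof -
  have "\<eta> ^ l \<in> C" unfolding \<eta> by (intro C.closed \<pi>_C)
  moreover have "\<eta> ^ l - 1 \<in> M" using \<pi> by (intro power_cong_1) (simp add: \<eta>)
  ultimately obtain x where "x \<in> C" "x ^ (2 ^ u) = \<eta> ^ l" "x - 1 \<in> M"
    using square_root_power[OF wC] by blast
  then show ?thesis using residues_inI[OF wC] C.uminus_closed by blast
qed

end

section \<open>Roots with residues in F_3\<close>

context place_3
begin

text \<open>Treats a cube root \<open>1 + 3 * c\<close> of \<open>m\<close> that is locally 3-adic.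
  The Eisenstein equation for \<open>\<eta> - 1\<close> has \<open>w\<close> congruent to
  \<open>c\<close>, so \<open>c\<close> has to be a unit.\<close>

lemma unramified_block:
  assumes c: "c \<in> V" "c \<notin> M" "c + 3 * c\<^sup>2 + 3 * c ^ 3 = of_int d" and \<eta>: "\<eta> ^ (3 ^ t) = 1 + 3 * c"
  shows "\<exists>x. x ^ (2 ^ u) = \<eta> ^ l \<and> x - 1 \<in> M \<and> residues_in F3_reps x \<and> residues_in F3_reps (- x)"
proof -
  define \<pi> where "\<pi> = \<eta> - 1"
  have "\<eta> ^ (3 ^ t) \<in> V" unfolding \<eta> using c by (intro closed)
  then have "\<eta> \<in> V" by (rule root_closed) simp
  then have \<pi>V: "\<pi> \<in> V" unfolding \<pi>_def by (intro closed)
  let ?G = "{poly f \<pi> | f. \<forall>i. coeff f i \<in> \<int>}"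
  interpret G: unital_subring ?G by (rule unital_subring.adjoin_subring[OF Ints_subring])
  have "\<pi> \<in> ?G"
    by (intro CollectI exI[of _ "[:0,1:]"]) (auto simp: coeff_pCons split: nat.splits)
  then obtain b where b: "b \<in> ?G" "(1 + \<pi>) ^ (3 ^ t) = 1 + \<pi> ^ (3 ^ t) + 3 * \<pi> * b"
    using G.one_plus_power_3 by blast
  have bV: "b \<in> V" using b(1) \<pi>V by (auto intro!: poly_closed intro: Ints_V)
  define w where "w = c - \<pi> * b"
  have \<pi>w: "\<pi> ^ (3 ^ t) = 3 * w"
    using b(2) \<eta> unfolding w_def \<pi>_def by (simp add: algebra_simps)
  have wV: "w \<in> V" unfolding w_def using c \<pi>V bV by (intro closed)
  have "\<pi> ^ (3 ^ t) \<in> M" unfolding \<pi>w using wV by (intro M_mult' three_M)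
  then have \<pi>M: "\<pi> \<in> M" using M_power \<pi>V by blast
  have wM: "w \<notin> M"
  proof -
    have "w - c \<in> M" unfolding w_def using M_uminus[OF M_mult'[OF \<pi>M bV]] by simp
    then show ?thesis using M_cong c by blast
  qed
  interpret T: totally_ramified_3 V \<pi> w "3 ^ t"
    unfolding totally_ramified_3_def
    using \<pi>M wV wM \<pi>w by (intro totally_ramified_Ints) auto
  have bC: "b \<in> T.C" using b(1) by (intro T.G_C) (simp add: T.G_def)
  have "c \<in> T.C"
    by (rule T.perturbed_cubic_fixpoint[of c 1 1 "of_int d"])
      (use c in \<open>auto simp: algebra_simps intro: T.C.closed\<close>)
  then have wC: "w \<in> T.C" unfolding w_def using T.\<pi>_C bC by (intro T.C.closed)
  show ?thesis by (rule T.residues_F3_opposites[OF wC]) (simp add: \<pi>_def)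
qed

lemma \<omega>_minus_1_square: "(\<omega> - 1)\<^sup>2 = - 3 * \<omega>"
proof -
  have "(\<omega> - 1)\<^sup>2 = \<omega>\<^sup>2 - 2 * \<omega> + 1" by (simp add: algebra_simps power2_eq_square)
  also have "\<dots> = - 3 * \<omega>" unfolding \<omega>_square by simp
  finally show ?thesis .
qed

lemma \<omega>_minus_1_M: "\<omega> - 1 \<in> M"
proof (rule M_power[of _ 2])
  have "- 3 * \<omega> = 3 * (- \<omega>)" by simp
  also have "\<dots> \<in> M" using \<omega>_V by (intro M_mult' three_M closed)
  finally show "(\<omega> - 1)\<^sup>2 \<in> M" unfolding \<omega>_minus_1_square .
qed (use \<omega>_V in \<open>auto intro: closed\<close>)

text \<open>Here the uniformizer is a \<open>3 ^ t\<close>-th root of \<open>\<omega> - 1\<close> up to a unit, and \<open>3\<close> is \<open>(\<omega> - 1)\<^sup>2\<close> up to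
  a unit.\<close>

lemma ramified_block:
  fixes d k :: int
  assumes c: "c \<in> V" "c + 3 * c\<^sup>2 + 3 * c ^ 3 = f"
    and f: "f \<in> V" "f + 3 * of_int k * (3 * f\<^sup>2 + 9 * f ^ 3) = of_int d"
    and \<eta>: "\<eta> ^ (3 ^ t) = \<omega> * (1 + 3 * c)"
  shows "\<exists>x. x ^ (2 ^ u) = \<eta> ^ l \<and> x - 1 \<in> M \<and> residues_in F3_reps x \<and> residues_in F3_reps (- x)"
proof -
  define \<pi> where "\<pi> = \<eta> - 1"
  have "\<eta> ^ (3 ^ t) \<in> V" unfolding \<eta> using c \<omega>_V by (intro closed)
  then have "\<eta> \<in> V" by (rule root_closed) simp
  then have \<pi>V: "\<pi> \<in> V" unfolding \<pi>_def by (intro closed)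
  let ?G = "{poly f \<pi> | f. \<forall>i. coeff f i \<in> \<int>}"
  interpret G: unital_subring ?G by (rule unital_subring.adjoin_subring[OF Ints_subring])
  have "\<pi> \<in> ?G"
    by (intro CollectI exI[of _ "[:0,1:]"]) (auto simp: coeff_pCons split: nat.splits)
  then obtain b where b: "b \<in> ?G" "(1 + \<pi>) ^ (3 ^ t) = 1 + \<pi> ^ (3 ^ t) + 3 * \<pi> * b"
    using G.one_plus_power_3 by blast
  have bV: "b \<in> V" using b(1) \<pi>V by (auto intro!: poly_closed intro: Ints_V)
  \<comment> \<open>Since 3 is \<open>(\<omega> - 1)\<^sup>2\<close> up to a unit, the term
    \<open>3 * (c * \<omega> - \<pi> * b)\<close> is negligible against \<open>\<omega> - 1\<close>.
    So \<open>w1\<close> is congruent to 1 for every \<open>c\<close> in \<open>V\<close>.\<close>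
  define w1 where "w1 = 1 - (\<omega> - 1) * \<omega>\<^sup>2 * (c * \<omega> - \<pi> * b)"
  have three: "3 = - (\<omega> - 1)\<^sup>2 * \<omega>\<^sup>2"
    unfolding \<omega>_minus_1_square using \<omega>_cube
    by (simp add: power2_eq_square power3_eq_cube mult.assoc)
  have \<pi>w1: "\<pi> ^ (3 ^ t) = (\<omega> - 1) * w1"
  proof -
    have "\<pi> ^ (3 ^ t) = (\<omega> - 1) + 3 * (c * \<omega> - \<pi> * b)"
      using b(2) \<eta> unfolding \<pi>_def by (simp add: algebra_simps)
    also have "\<dots> = (\<omega> - 1) * w1"
      unfolding w1_def by (subst three) (simp add: algebra_simps power2_eq_square)
    finally show ?thesis .
  qed
  have w1V: "w1 \<in> V" unfolding w1_def using c \<pi>V bV \<omega>_V by (intro closed)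
  have \<pi>M: "\<pi> \<in> M"
    using M_power[OF \<pi>V, of "3 ^ t"] M_mult'[OF \<omega>_minus_1_M w1V] \<pi>w1 by simp
  \<comment> \<open>Squaring trades \<open>\<omega> - 1\<close> for 3 and doubles the ramification
    index.\<close>
  define w where "w = - \<omega> * w1\<^sup>2"
  have \<pi>w: "\<pi> ^ (3 ^ t * 2) = 3 * w"
    unfolding power_mult \<pi>w1 power_mult_distrib \<omega>_minus_1_square w_def by simp
  have wV: "w \<in> V" unfolding w_def using w1V \<omega>_V by (intro closed)
  have "1 - w1 = (\<omega> - 1) * (\<omega>\<^sup>2 * (c * \<omega> - \<pi> * b))" unfolding w1_def by simp
  also have "\<dots> \<in> M" using c \<pi>V bV \<omega>_V by (intro M_mult' \<omega>_minus_1_M closed)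
  finally have "w1 \<notin> M" using M_cong one_not_M by blast
  moreover have "\<omega> \<notin> M"
  proof
    assume "\<omega> \<in> M"
    then have "\<omega> ^ 3 \<in> M" unfolding power3_eq_cube using \<omega>_V by (intro M_mult' closed)
    then show False using \<omega>_cube one_not_M by simp
  qed
  ultimately have wM: "w \<notin> M"
    using M_prime[of \<omega> "w1\<^sup>2"] M_power[of w1 2] M_uminus[of w] \<omega>_V w1V closed
    unfolding w_def by auto
  interpret T: totally_ramified_3 V \<pi> w "3 ^ t * 2"
    unfolding totally_ramified_3_def
    using \<pi>M wV wM \<pi>w by (intro totally_ramified_Ints) auto
  have bC: "b \<in> T.C" using b(1) by (intro T.G_C) (simp add: T.G_def)
  have "f \<in> T.C"
    by (rule T.perturbed_cubic_fixpoint[of f "of_int (3 * k)" "of_int (9 * k)" "of_int d"])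
      (use f in \<open>auto simp: algebra_simps intro!: T.C.closed\<close>)
  then have cC: "c \<in> T.C"
    by (intro T.perturbed_cubic_fixpoint[of c 1 1 f])
      (use c in \<open>auto simp: algebra_simps intro: T.C.closed\<close>)
  have \<eta>C: "\<eta> \<in> T.C" using T.C.add_closed[OF T.\<pi>_C T.C.one_closed] by (simp add: \<pi>_def)
  have "1 + 3 * c - 1 \<in> M" using M_mult'[OF three_M c(1)] by simp
  then have c1: "1 + 3 * c \<notin> M" using M_cong one_not_M by blast
  \<comment> \<open>The coefficients are integers only, so \<open>\<omega>\<close> has to be
    recovered from \<open>\<eta>\<close>; this is possible because \<open>c\<close> was placed in
    \<open>C\<close> by equations free of \<open>\<omega>\<close>.\<close>
  have "\<omega> = \<eta> ^ (3 ^ t) * inverse (1 + 3 * c)" using not_M_nz[OF c1] unfolding \<eta> by simp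
  also have "\<dots> \<in> T.C" using \<eta>C cC c1 by (intro T.C.mult_closed T.C.power_closed T.inverse_C T.C.closed(6) T.C.one_closed T.C.numeral_closed)
  finally have "w \<in> T.C" unfolding w_def w1_def using cC bC T.\<pi>_C by (intro T.C.closed)
  then show ?thesis by (rule T.residues_F3_opposites) (simp add: \<pi>_def)
qed

text \<open>Multiplying \<open>y = 1 + (x - 1) + (x - 1)\<^sup>2 / 3\<close> by
  \<open>y\<^sup>2\<close> and replacing \<open>(x - 1) * y\<close> by \<open>3 * e\<close> gives
  the monic cubic. It serves twice: for integrality in \<open>V\<close>, and for the algebraic
  integer that separates cube roots of \<open>m\<close>.\<close>

lemma trace_cubic:
  fixes x e :: complex
  assumes "x ^ 3 = 1 + 9 * e"
  defines "y \<equiv> (1 + x + x\<^sup>2) / 3"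
  shows "y ^ 3 + (- 1) * y\<^sup>2 + (- 3 * e) * y + (- 3 * e\<^sup>2) = 0" "(x - 1) * y = 3 * e"
proof -
  have "3 * ((x - 1) * y) = x ^ 3 - 1"
    unfolding y_def by (simp add: field_simps power2_eq_square power3_eq_cube)
  then have "3 * ((x - 1) * y) = 3 * (3 * e)" using assms(1) by simp
  then have xy: "(x - 1) * y = 3 * e" by (metis mult_cancel_left zero_neq_numeral)
  have "y = 1 + (x - 1) + (x - 1)\<^sup>2 / 3"
    unfolding y_def by (simp add: field_simps power2_eq_square)
  then have "y ^ 3 = (1 + (x - 1) + (x - 1)\<^sup>2 / 3) * y\<^sup>2" by (simp add: power2_eq_square power3_eq_cube)
  also have "\<dots> = y\<^sup>2 + ((x - 1) * y) * y + ((x - 1) * y)\<^sup>2 / 3"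
    by (simp add: algebra_simps power2_eq_square add_divide_distrib diff_divide_distrib)
  finally show "y ^ 3 + (- 1) * y\<^sup>2 + (- 3 * e) * y + (- 3 * e\<^sup>2) = 0"
    unfolding xy by (simp add: power2_eq_square)
  show "(x - 1) * y = 3 * e" by (fact xy)
qed

text \<open>The values of \<open>(1 + z + z\<^sup>2) / 3\<close> at the three cube roots
  \<open>z\<close> of \<open>1 + 9 * e\<close> lie in \<open>V\<close> and sum to 1, so one is a
  unit; dividing \<open>(z - 1) * y z = 3 * e\<close> by it gives
  \<open>z = 1 + 3 * c\<close>.\<close>

lemma cube_root_near_1:
  assumes e: "e \<in> V"
  obtains c where "c \<in> V" "c + 3 * c\<^sup>2 + 3 * c ^ 3 = e"
proof -
  obtain x where x: "x ^ 3 = 1 + 9 * e" using nth_root_exists[of 3 "1 + 9 * e"] by auto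
  define y where "y = (\<lambda>x::complex. (1 + x + x\<^sup>2) / 3)"
  have cube: "(\<omega> ^ i * x) ^ 3 = 1 + 9 * e" for i
    using x \<omega>_power_mult_3[of 3 i] by (simp add: power_mult_distrib)
  have yV: "y (\<omega> ^ i * x) \<in> V" for i
  proof (rule cubic_root_closed)
    show "y (\<omega> ^ i * x) ^ 3 + (- 1) * (y (\<omega> ^ i * x))\<^sup>2 + (- 3 * e) * y (\<omega> ^ i * x) + (- 3 * e\<^sup>2) = 0"
      unfolding y_def by (rule trace_cubic(1)[OF cube])
  qed (use e in \<open>auto intro!: closed\<close>)
  have "y (\<omega> ^ 0 * x) + y (\<omega> ^ 1 * x) + y (\<omega> ^ 2 * x)
      = 1 + (1 + \<omega> + \<omega>\<^sup>2) * x / 3 + (1 + \<omega>\<^sup>2 + \<omega> ^ 3 * \<omega>) * x\<^sup>2 / 3"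
    unfolding y_def by (simp add: algebra_simps add_divide_distrib power2_eq_square power3_eq_cube)
  also have "\<dots> = 1" unfolding \<omega>_cube \<omega>_square by simp
  finally obtain i where i: "y (\<omega> ^ i * x) \<notin> M"
    using M_add one_not_M by metis
  define z where "z = \<omega> ^ i * x"
  define c where "c = e * inverse (y z)"
  have cV: "c \<in> V" unfolding c_def z_def by (intro closed e inverse_closed i yV)
  have "(z - 1) * y z = 3 * e" using trace_cubic(2)[OF cube[of i]] unfolding y_def z_def .
  then have "z = 1 + 3 * c" unfolding c_def using not_M_nz[OF i] by (simp add: z_def field_simps)
  then have "(1 + 3 * c) ^ 3 = 1 + 9 * e" using cube[of i] by (simp add: z_def)
  moreover have "(1 + 3 * c) ^ 3 = 1 + 9 * (c + 3 * c\<^sup>2 + 3 * c ^ 3)"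
    by (simp add: algebra_simps power2_eq_square power3_eq_cube)
  ultimately have "9 * (c + 3 * c\<^sup>2 + 3 * c ^ 3) = 9 * e" by (metis add_left_cancel)
  then show ?thesis using that[OF cV] by (metis mult_cancel_left zero_neq_numeral)
qed

text \<open>If \<open>c\<close> is not a unit, then \<open>1 + 3 * c\<close> has the form
  \<open>1 + 9 * e\<close> and is the cube of some \<open>1 + 3 * c'\<close>. Here \<open>c'\<close>
  may again fail to be a unit, so the cube root \<open>\<omega> * (1 + 3 * c')\<close> is taken
  instead, where ramification is automatic.\<close>

lemma first_block:
  assumes c: "c \<in> V" "c + 3 * c\<^sup>2 + 3 * c ^ 3 = of_int d" and v: "v > 0"
  shows "\<exists>x. x ^ (2 ^ u * 3 ^ (v - 1)) = 1 + 3 * c \<and> x - 1 \<in> M \<and> residues_in F3_reps x \<and> residues_in F3_reps (- x)"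
proof (cases "c \<in> M")
  case False
  obtain \<eta> where \<eta>: "\<eta> ^ (3 ^ (v - 1)) = 1 + 3 * c" using nth_root_exists[of "3 ^ (v - 1)" "1 + 3 * c"] by auto
  from unramified_block[OF c(1) False c(2) \<eta>, of u 1] show ?thesis using \<eta> by (auto simp: power_mult)
next
  case True
  let ?q = "1 + 3 * c + 3 * c\<^sup>2"
  have cq: "c * ?q = of_int d" using c(2) by (simp add: algebra_simps power2_eq_square power3_eq_cube)
  have "?q - 1 = 3 * (c + c\<^sup>2)" by simp
  also have "\<dots> \<in> M" using c by (intro M_mult' three_M closed)
  finally have q: "?q \<notin> M" using M_cong one_not_M by blast
  have "of_int d \<in> M" unfolding cq[symmetric] using c by (intro M_mult' True closed)
  then obtain d' where d': "d = 3 * d'" using M_of_int_iff by auto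
  define e where "e = of_int d' * inverse ?q"
  have eV: "e \<in> V" unfolding e_def using q c by (intro mult_closed of_int_closed inverse_closed closed(6) numeral_closed one_closed power_closed)
  have ce: "c = 3 * e" using cq d' not_M_nz[OF q] unfolding e_def by (simp add: field_simps)
  have "3 * (e + 3 * of_int 1 * (3 * e\<^sup>2 + 9 * e ^ 3)) = c + 3 * c\<^sup>2 + 3 * c ^ 3"
    unfolding ce by (simp add: power_mult_distrib algebra_simps)
  also have "\<dots> = 3 * of_int d'" using c(2) d' by simp
  finally have ed: "e + 3 * of_int 1 * (3 * e\<^sup>2 + 9 * e ^ 3) = of_int d'"
    by (metis mult_cancel_left zero_neq_numeral)
  obtain c' where c': "c' \<in> V" "c' + 3 * c'\<^sup>2 + 3 * c' ^ 3 = e" by (rule cube_root_near_1[OF eV])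
  obtain \<eta> where \<eta>: "\<eta> ^ (3 ^ (v - 2)) = \<omega> * (1 + 3 * c')"
    using nth_root_exists[of "3 ^ (v - 2)" "\<omega> * (1 + 3 * c')"] by auto
  \<comment> \<open>For \<open>v = 1\<close> the exponent \<open>v - 2\<close> truncates to 0 and
    \<open>\<eta>\<close> is itself a cube root of \<open>1 + 3 * c\<close>; its third power leads
    back.\<close>
  define l :: nat where "l = (if v = 1 then 3 else 1)"
  have l: "l * 3 ^ (v - 1) = 3 ^ (v - 2) * 3"
  proof (cases "v = 1")
    case False
    then have "v - 1 = Suc (v - 2)" using v by simp
    then show ?thesis using False by (simp add: l_def)
  qed (simp add: l_def)
  obtain x where x: "x ^ (2 ^ u) = \<eta> ^ l" "x - 1 \<in> M" "residues_in F3_reps x" "residues_in F3_reps (- x)"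
    using ramified_block[OF c' eV ed \<eta>, of u l] by auto
  have "x ^ (2 ^ u * 3 ^ (v - 1)) = (\<eta> ^ (3 ^ (v - 2))) ^ 3"
    unfolding power_mult x(1) by (simp only: l flip: power_mult)
  also have "\<dots> = (1 + 3 * c') ^ 3" unfolding \<eta> power_mult_distrib \<omega>_cube by simp
  also have "\<dots> = 1 + 9 * (c' + 3 * c'\<^sup>2 + 3 * c' ^ 3)"
    by (simp add: algebra_simps power2_eq_square power3_eq_cube)
  also have "\<dots> = 1 + 3 * c" unfolding c'(2) ce by simp
  finally show ?thesis using x by blast
qed

lemma second_block:
  assumes c: "c \<in> V" "c + 3 * c\<^sup>2 + 3 * c ^ 3 = of_int d"
  shows "\<exists>x. x ^ (2 ^ u * 3 ^ k) = \<omega> * (1 + 3 * c) \<and> x - 1 \<in> M \<and> residues_in F3_reps x \<and> residues_in F3_reps (- x)"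
proof -
  obtain \<eta> where \<eta>: "\<eta> ^ (3 ^ k) = \<omega> * (1 + 3 * c)" using nth_root_exists[of "3 ^ k" "\<omega> * (1 + 3 * c)"] by auto
  from ramified_block[OF c of_int_closed _ \<eta>, of 0 d u 1] show ?thesis using \<eta> by (auto simp: power_mult)
qed

end

lemma (in place_3) not_monogenic_mod_9:
  fixes m :: int
  assumes u: "u > 0" and v: "v > 0" and m: "[m = 1] (mod 9)"
    and F: "F = Polynomial.monom 1 (2 ^ u * 3 ^ v) - [:of_int m:]" "Factorial_Ring.irreducible F" "ratpoly F \<alpha> = 0"
  shows "\<not> monogenic (rat_adjoin \<alpha>)"
proof -
  obtain d where d: "m = 1 + 9 * d" using m by (metis cong_iff_lin mult.commute cong_sym)
  let ?N = "2 ^ u * 3 ^ (v - 1) :: nat"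
  have N: "2 ^ u * 3 ^ v = ?N * 3" using v by (cases v) auto
  \<comment> \<open>Keeps \<open>x\<close> and \<open>- x\<close> above the same cube root of
    \<open>m\<close>.\<close>
  have evenN: "even ?N" using u by simp
  have F_eval: "ratpoly F x = (x ^ ?N) ^ 3 - of_int m" for x
    unfolding F(1) N by (simp add: ratpoly_diff ratpoly_monom ratpoly_const power_mult)
  obtain c where c: "c \<in> V" "c + 3 * c\<^sup>2 + 3 * c ^ 3 = of_int d" by (rule cube_root_near_1[OF of_int_closed])
  define b where "b = 1 + 3 * c"
  have b3: "b ^ 3 = of_int m"
  proof -
    have "b ^ 3 = 1 + 9 * (c + 3 * c\<^sup>2 + 3 * c ^ 3)"
      unfolding b_def by (simp add: algebra_simps power2_eq_square power3_eq_cube)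
    then show ?thesis unfolding c(2) d by simp
  qed
  obtain x0 where x0: "x0 ^ ?N = b" "x0 - 1 \<in> M" "residues_in F3_reps x0" "residues_in F3_reps (- x0)"
    using first_block[OF c v] unfolding b_def by blast
  obtain x1 where x1: "x1 ^ ?N = \<omega> * b" "x1 - 1 \<in> M" "residues_in F3_reps x1" "residues_in F3_reps (- x1)"
    using second_block[OF c] unfolding b_def by blast
  define x where "x = (\<lambda>i::nat. if i = 0 then x0 else x1)"
  define r where "r = (\<lambda>(i, j::nat). if j = 0 then x i else - x i)"
  have x: "x i - 1 \<in> M" for i using x0 x1 by (simp add: x_def)
  have rN: "r (i, j) ^ ?N = (if i = 0 then b else \<omega> * b)" for i j
    unfolding r_def using x0 x1 evenN by (auto simp: x_def)
  \<comment> \<open>The third cube root \<open>\<omega>\<^sup>2 * b\<close> is left out: the values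
    of \<open>(1 + s + s\<^sup>2) / 3\<close> at the three cube roots sum to 1 and are congruent to
    1, 0, 0 modulo \<open>M\<close>, so it is not separated from
    \<open>\<omega> * b\<close>.\<close>
  let ?I = "{0, 1::nat} \<times> {0, 1::nat}"
  show ?thesis
  proof (rule not_monogenic_if_many_residues[OF F(2,3), of ?I r F3_reps])
    show "ratpoly F (r i) = 0" for i
      using rN[of "fst i" "snd i"] b3 \<omega>_cube by (simp add: F_eval power_mult_distrib)
    have "card F3_reps \<le> 3" unfolding F3_reps_def using card_length[of "[0, 1, 2 :: complex]"] by simp
    then show "card F3_reps < card ?I" by (simp add: card_cartesian_product)
    show "finite F3_reps" by (simp add: F3_reps_def)
    have "residues_in F3_reps (r i)" for i
      using x0 x1 by (auto simp: r_def x_def case_prod_unfold)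
    then show "\<exists>a\<in>F3_reps. ratpoly g (r i) - a \<in> M" if "ratpoly g (r i) \<in> V" for i g
      using that unfolding residues_in_def by blast
  next
    fix i j assume ij: "i \<in> ?I" "j \<in> ?I" "i \<noteq> j"
    obtain i1 i2 j1 j2 where e: "i = (i1, i2)" "j = (j1, j2)" by fastforce
    show "\<exists>h. algebraic_int (ratpoly h \<alpha>) \<and> ratpoly h (r i) - ratpoly h (r j) \<notin> M"
    proof (cases "i1 = j1")
      case True
      have "algebraic_int \<alpha>" using algebraic_int_root_monom[OF F(1) _ F(3)] by simp
      moreover have "r i - r j \<notin> M"
      proof
        assume "r i - r j \<in> M"
        moreover have "r i - r j = 2 * x i1 \<or> r i - r j = - (2 * x i1)"
          using True ij e by (auto simp: r_def)
        ultimately have "2 * x i1 \<in> M" using M_uminus by fastforce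
        moreover have "2 * x i1 - of_int 2 = 2 * (x i1 - 1)" by simp
        then have "2 * x i1 - of_int 2 \<in> M" using M_mult[OF numeral_closed x] by metis
        ultimately have "of_int 2 \<in> M" using M_cong by blast
        then show False using of_int_not_M[of 2] by simp
      qed
      ultimately show ?thesis by (intro exI[of _ "[:0,1:]"]) (simp add: ratpoly_pCons)
    next
      case False
      let ?h = "smult (1/3) (1 + Polynomial.monom 1 ?N + Polynomial.monom 1 (?N * 2))"
      have h: "ratpoly ?h y = (1 + y ^ ?N + (y ^ ?N)\<^sup>2) / 3" for y
        using ratpoly_const[of 1 y]
        by (simp add: ratpoly_smult ratpoly_add ratpoly_monom of_rat_divide one_pCons flip: power_mult)
      have alg: "algebraic_int (ratpoly ?h \<alpha>)"
      proof (rule algebraic_int.intros)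
        define y where "y = ratpoly ?h \<alpha>"
        have "(\<alpha> ^ ?N) ^ 3 = 1 + 9 * of_int d" using F(3) d unfolding F_eval by simp
        from trace_cubic(1)[OF this]
        have "y ^ 3 + (- 1) * y\<^sup>2 + (- 3 * of_int d) * y + (- 3 * (of_int d)\<^sup>2) = 0"
          unfolding y_def h .
        then show "poly [:- 3 * (of_int d)\<^sup>2, - 3 * of_int d, - 1, 1:] (ratpoly ?h \<alpha>) = 0"
          unfolding y_def[symmetric] by (simp add: algebra_simps power2_eq_square power3_eq_cube)
      qed (auto simp: coeff_pCons split: nat.splits)
      have hb: "(1 + b + b\<^sup>2) / 3 - 1 \<in> M"
      proof -
        have "(1 + b + b\<^sup>2) / 3 - 1 = 3 * (c + c\<^sup>2)"
          unfolding b_def by (simp add: field_simps power2_eq_square)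
        also have "\<dots> \<in> M" using c by (intro M_mult' three_M closed)
        finally show ?thesis .
      qed
      have h\<omega>: "(1 + \<omega> * b + (\<omega> * b)\<^sup>2) / 3 \<in> M"
      proof -
        \<comment> \<open>The factorization of \<open>X\<^sup>2 + X + 1\<close> at
          \<open>X = \<omega> * b\<close>: the first factor is \<open>3 * \<omega> * c\<close> and
          cancels the denominator, the second lies in \<open>M\<close>.\<close>
        have "(\<omega> * b - \<omega>) * (\<omega> * b - \<omega>\<^sup>2) = (\<omega> * b)\<^sup>2 - (\<omega> + \<omega>\<^sup>2) * (\<omega> * b) + \<omega> ^ 3"
          by (simp add: algebra_simps power2_eq_square power3_eq_cube)
        also have "\<dots> = 1 + \<omega> * b + (\<omega> * b)\<^sup>2" unfolding \<omega>_cube \<omega>_square by simp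
        also have "(\<omega> * b - \<omega>) * (\<omega> * b - \<omega>\<^sup>2) = 3 * ((3 * c - (\<omega> - 1)) * (\<omega>\<^sup>2 * c))"
          unfolding b_def by (simp add: algebra_simps power2_eq_square)
        finally have "(1 + \<omega> * b + (\<omega> * b)\<^sup>2) / 3 = (3 * c - (\<omega> - 1)) * (\<omega>\<^sup>2 * c)"
          by (metis nonzero_mult_div_cancel_left zero_neq_numeral)
        also have "\<dots> \<in> M"
          using c \<omega>_V by (intro M_mult'[OF M_diff[OF M_mult'[OF three_M c(1)] \<omega>_minus_1_M]] closed)
        finally show ?thesis .
      qed
      let ?D = "(1 + b + b\<^sup>2) / 3 - (1 + \<omega> * b + (\<omega> * b)\<^sup>2) / 3"
      have "?D - 1 \<in> M" using M_diff[OF hb h\<omega>] by (simp add: algebra_simps)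
      then have D: "?D \<notin> M" using M_cong one_not_M by blast
      have "ratpoly ?h (r i) - ratpoly ?h (r j) = ?D \<or> ratpoly ?h (r i) - ratpoly ?h (r j) = - ?D"
        unfolding h e rN using False ij e by auto
      then have "ratpoly ?h (r i) - ratpoly ?h (r j) \<notin> M" using D M_uminus by fastforce
      with alg show ?thesis by blast
    qed
  qed
qed

theorem theorem2p2:
  fixes u v :: nat and m :: int and F :: "rat poly" and \<alpha> :: complex and K :: "complex set"
  assumes "u > 0" and "v > 0"
    and "squarefree m" and "m \<noteq> 1" and "m \<noteq> -1"
    and "F = Polynomial.monom 1 (2 ^ u * 3 ^ v) - [:of_int m:]"
    and "lead_coeff F = 1" and "Factorial_Ring.irreducible F"
    and "poly (map_poly of_rat F) \<alpha> = 0"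
    and "K = rat_adjoin \<alpha>"
    and "[m = 1] (mod 4) \<or> [m = 1] (mod 9)"
  shows "\<not> monogenic K"
proof -
  have \<alpha>: "ratpoly F \<alpha> = 0" by (fact assms(9))
  from assms(11) show ?thesis
  proof
    assume m: "[m = 1] (mod 4)"
    obtain V where "place V 2" using place_exists[OF two_is_prime_nat] .
    then interpret place_2 V by (simp add: place_2_def)
    show ?thesis unfolding assms(10)
      by (rule not_monogenic_mod_4[OF assms(1,2) m assms(6,8) \<alpha>])
  next
    assume m: "[m = 1] (mod 9)"
    have "Factorial_Ring.prime (3 :: nat)" by simp
    then obtain V where "place V 3" by (rule place_exists)
    then interpret place_3 V by (simp add: place_3_def)
    show ?thesis unfolding assms(10)
      by (rule not_monogenic_mod_9[OF assms(1,2) m assms(6,8) \<alpha>])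
  qed
qed

end
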